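(* Let $(\Omega,\Sigma,\mu)$ be a measure space and let $Y$ be a strictly convex Banach space over $\mathbb K\in\{\mathbb R,\mathbb C\}$ with $\dim(Y)\geq2$. If $\mu$ is not purely atomic, then $\mathrm{NA}_\pi(L_1(\mu)\widehat{\otimes}_\pi Y)$ is not a $G_\delta$ subset of $L_1(\mu)\widehat{\otimes}_\pi Y$ (in the norm topology).
   Context: $X\widehat{\otimes}_\pi Y$ denotes the projective tensor product. An element $u\in X\widehat{\otimes}_\pi Y$ attains its projective norm if there are $(x_i)\subseteq X$, $(y_i)\subseteq Y$ with $u=\sum_{i=1}^\infty x_i\otimes y_i$ and $\|u\|_\pi=\sum_{i=1}^\infty\|x_i\|\|y_i\|$; $\mathrm{NA}_\pi(X\widehat{\otimes}_\pi Y)$ is the set of such elements. $Y$ is strictly convex if $\|x+y\|<2$ for all distinct unit vectors $x,y\in Y$. A set $A\in\Sigma$ is an atom if $0<\mu(A)<\infty$ and every measurable $B\subseteq A$ has $\mu(B)=0$ or $\mu(B)=\mu(A)$. A set $E\in\Sigma$ with $0<\mu(E)<\infty$ is purely atomic if it coincides, modulo a null set, with the union of the (countably many, modulo null sets) atoms contained in $E$; $\mu$ is purely atomic if every $E\in\Sigma$ with $0<\mu(E)<\infty$ is purely atomic. *)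

theory Defs
  imports "HOL-Analysis.Analysis"
begin

text \<open>Scalars. The class contains exactly the isometric copies of the fields of real and of
  complex numbers.\<close>

class real_or_complex = real_normed_field + banach + second_countable_topology +
  assumes real_or_complex:
    "(\<exists>\<phi> :: 'a \<Rightarrow> real. bij \<phi> \<and> (\<forall>a b. \<phi> (a + b) = \<phi> a + \<phi> b) \<and>
        (\<forall>a b. \<phi> (a * b) = \<phi> a * \<phi> b) \<and> (\<forall>a. norm (\<phi> a) = norm a)) \<or>
     (\<exists>\<phi> :: 'a \<Rightarrow> complex. bij \<phi> \<and> (\<forall>a b. \<phi> (a + b) = \<phi> a + \<phi> b) \<and>
        (\<forall>a b. \<phi> (a * b) = \<phi> a * \<phi> b) \<and> (\<forall>a. norm (\<phi> a) = norm a))"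

instance real :: real_or_complex
  by standard (rule disjI1, rule exI[of _ id], simp)

instance complex :: real_or_complex
  by standard (rule disjI2, rule exI[of _ id], simp)

text \<open>A normed space over \<open>'k\<close> on a whole type. The type class of the library only provides real
  scalar multiplication; \<open>scl\<close> extends it to \<open>'k\<close>.\<close>

locale normed_space_over = vector_space scl
  for scl :: "'k::real_or_complex \<Rightarrow> 'y::real_normed_vector \<Rightarrow> 'y" +
  assumes norm_scale: "norm (scl a y) = norm a * norm y"
    and scale_of_real: "scl (of_real r) y = r *\<^sub>R y"

text \<open>Normed spaces with an explicit carrier. These are needed because \<open>L\<^sub>1(\<mu>)\<close> depends on the
  measure \<open>\<mu>\<close> and is therefore not a type.\<close>

record ('k, 'v) nspace =
  vcarrier :: "'v set"
  vzero :: 'v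
  vadd :: "'v \<Rightarrow> 'v \<Rightarrow> 'v"
  vscale :: "'k \<Rightarrow> 'v \<Rightarrow> 'v"
  vnorm :: "'v \<Rightarrow> real"

definition vdist :: "('k::real_or_complex, 'v) nspace \<Rightarrow> 'v \<Rightarrow> 'v \<Rightarrow> real" where
  "vdist V u v = vnorm V (vadd V u (vscale V (- 1) v))"

text \<open>The topology of the norm. \<open>Metric_space.mtopology\<close> is not used because that locale demands a
  distance function which is symmetric and nonnegative also outside the carrier.\<close>

definition norm_topology :: "('k::real_or_complex, 'v) nspace \<Rightarrow> 'v topology" where
  "norm_topology V = topology (\<lambda>U. U \<subseteq> vcarrier V \<and>
     (\<forall>u\<in>U. \<exists>r>0. \<forall>v\<in>vcarrier V. vdist V u v < r \<longrightarrow> v \<in> U))"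

lemma openin_norm_topology:
  "openin (norm_topology V) U \<longleftrightarrow> U \<subseteq> vcarrier V \<and>
     (\<forall>u\<in>U. \<exists>r>0. \<forall>v\<in>vcarrier V. vdist V u v < r \<longrightarrow> v \<in> U)"
proof -
  have "istopology (\<lambda>U. U \<subseteq> vcarrier V \<and>
      (\<forall>u\<in>U. \<exists>r>0. \<forall>v\<in>vcarrier V. vdist V u v < r \<longrightarrow> v \<in> U))"
    unfolding istopology_def
  proof (intro conjI allI impI ballI)
    fix S T u
    assume S: "S \<subseteq> vcarrier V \<and> (\<forall>u\<in>S. \<exists>r>0. \<forall>v\<in>vcarrier V. vdist V u v < r \<longrightarrow> v \<in> S)"
      and T: "T \<subseteq> vcarrier V \<and> (\<forall>u\<in>T. \<exists>r>0. \<forall>v\<in>vcarrier V. vdist V u v < r \<longrightarrow> v \<in> T)"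
    from S show "S \<inter> T \<subseteq> vcarrier V" by (meson inf.coboundedI1)
    assume "u \<in> S \<inter> T"
    then have "u \<in> S" "u \<in> T" by auto
    from S[THEN conjunct2, THEN bspec, OF this(1)] T[THEN conjunct2, THEN bspec, OF this(2)]
    obtain r r' where "r > 0" "\<forall>v\<in>vcarrier V. vdist V u v < r \<longrightarrow> v \<in> S"
      and "r' > 0" "\<forall>v\<in>vcarrier V. vdist V u v < r' \<longrightarrow> v \<in> T" by blast
    then show "\<exists>r>0. \<forall>v\<in>vcarrier V. vdist V u v < r \<longrightarrow> v \<in> S \<inter> T"
      by (intro exI[of _ "min r r'"]) auto
  next
    fix \<U> u
    assume U: "\<forall>U\<in>\<U>. U \<subseteq> vcarrier V \<and>
        (\<forall>u\<in>U. \<exists>r>0. \<forall>v\<in>vcarrier V. vdist V u v < r \<longrightarrow> v \<in> U)"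
    then show "\<Union>\<U> \<subseteq> vcarrier V" by (meson Union_least)
    assume "u \<in> \<Union>\<U>"
    with U show "\<exists>r>0. \<forall>v\<in>vcarrier V. vdist V u v < r \<longrightarrow> v \<in> \<Union>\<U>" by (meson UnionE UnionI)
  qed
  then show ?thesis unfolding norm_topology_def by (rule fun_cong[OF topology_inverse'])
qed

lemma topspace_norm_topology: "topspace (norm_topology V) = vcarrier V"
proof
  show "topspace (norm_topology V) \<subseteq> vcarrier V"
    by (rule openin_norm_topology[THEN iffD1, OF openin_topspace, THEN conjunct1])
  have "openin (norm_topology V) (vcarrier V)"
    by (auto simp: openin_norm_topology intro: exI[of _ 1])
  then show "vcarrier V \<subseteq> topspace (norm_topology V)" by (rule openin_subset)
qed

definition nspace_of :: "('k::real_or_complex \<Rightarrow> 'y::real_normed_vector \<Rightarrow> 'y) \<Rightarrow> ('k, 'y) nspace" where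
  "nspace_of scl =
     \<lparr>vcarrier = UNIV, vzero = 0, vadd = (+), vscale = scl, vnorm = norm\<rparr>"

definition strictly_convex :: "('k::real_or_complex, 'v) nspace \<Rightarrow> bool" where
  "strictly_convex V \<longleftrightarrow>
     (\<forall>x\<in>vcarrier V. \<forall>y\<in>vcarrier V.
        vnorm V x = 1 \<and> vnorm V y = 1 \<and> x \<noteq> y \<longrightarrow> vnorm V (vadd V x y) < 2)"

text \<open>\<open>L\<^sub>1(\<mu>)\<close>: its elements are the classes of integrable scalar functions modulo equality
  almost everywhere.\<close>

definition ae_rel :: "'a measure \<Rightarrow> (('a \<Rightarrow> 'k::real_or_complex) \<times> ('a \<Rightarrow> 'k)) set" where
  "ae_rel M = {(f, g). integrable M f \<and> integrable M g \<and> (AE \<omega> in M. f \<omega> = g \<omega>)}"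

definition L1 :: "'a measure \<Rightarrow> ('k::real_or_complex, ('a \<Rightarrow> 'k) set) nspace" where
  "L1 M =
     \<lparr>vcarrier = {f. integrable M f} // ae_rel M,
      vzero = ae_rel M `` {\<lambda>_. 0},
      vadd = (\<lambda>F G. ae_rel M `` {\<lambda>\<omega>. (SOME f. f \<in> F) \<omega> + (SOME g. g \<in> G) \<omega>}),
      vscale = (\<lambda>a F. ae_rel M `` {\<lambda>\<omega>. a * (SOME f. f \<in> F) \<omega>}),
      vnorm = (\<lambda>F. \<integral>\<omega>. norm ((SOME f. f \<in> F) \<omega>) \<partial>M)\<rparr>"

text \<open>The algebraic tensor product: \<open>x \<otimes> y\<close> is evaluation at \<open>(x, y)\<close> on the space of all (not
  necessarily bounded) bilinear forms on \<open>X \<times> Y\<close>, and \<open>X \<otimes> Y\<close> consists of the finite sums of such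
  functionals. Finite families are written as the first \<open>n\<close> terms of a sequence.\<close>

definition bilinear_form ::
    "('k::real_or_complex, 'x) nspace \<Rightarrow> ('k, 'y) nspace \<Rightarrow> ('x \<Rightarrow> 'y \<Rightarrow> 'k) \<Rightarrow> bool" where
  "bilinear_form X Y B \<longleftrightarrow>
     (\<forall>x\<in>vcarrier X. \<forall>x'\<in>vcarrier X. \<forall>y\<in>vcarrier Y. B (vadd X x x') y = B x y + B x' y) \<and>
     (\<forall>a. \<forall>x\<in>vcarrier X. \<forall>y\<in>vcarrier Y. B (vscale X a x) y = a * B x y) \<and>
     (\<forall>x\<in>vcarrier X. \<forall>y\<in>vcarrier Y. \<forall>y'\<in>vcarrier Y. B x (vadd Y y y') = B x y + B x y') \<and>
     (\<forall>a. \<forall>x\<in>vcarrier X. \<forall>y\<in>vcarrier Y. B x (vscale Y a y) = a * B x y)"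

type_synonym ('k, 'x, 'y) tensor = "('x \<Rightarrow> 'y \<Rightarrow> 'k) \<Rightarrow> 'k"

definition elem_tensor ::
    "('k::real_or_complex, 'x) nspace \<Rightarrow> ('k, 'y) nspace \<Rightarrow> 'x \<Rightarrow> 'y \<Rightarrow> ('k, 'x, 'y) tensor" where
  "elem_tensor X Y x y = (\<lambda>B. if bilinear_form X Y B then B x y else 0)"

definition tensor_sum ::
    "('k::real_or_complex, 'x) nspace \<Rightarrow> ('k, 'y) nspace \<Rightarrow>
     nat \<Rightarrow> (nat \<Rightarrow> 'x) \<Rightarrow> (nat \<Rightarrow> 'y) \<Rightarrow> ('k, 'x, 'y) tensor" where
  "tensor_sum X Y n x y = (\<lambda>B. \<Sum>i<n. elem_tensor X Y (x i) (y i) B)"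

definition projective_norm ::
    "('k::real_or_complex, 'x) nspace \<Rightarrow> ('k, 'y) nspace \<Rightarrow> ('k, 'x, 'y) tensor \<Rightarrow> real" where
  "projective_norm X Y u =
     Inf {\<Sum>i<n. vnorm X (x i) * vnorm Y (y i) | n x y.
            (\<forall>i<n. x i \<in> vcarrier X \<and> y i \<in> vcarrier Y) \<and> u = tensor_sum X Y n x y}"

definition algebraic_tensor ::
    "('k::real_or_complex, 'x) nspace \<Rightarrow> ('k, 'y) nspace \<Rightarrow> ('k, ('k, 'x, 'y) tensor) nspace" where
  "algebraic_tensor X Y =
     \<lparr>vcarrier = {tensor_sum X Y n x y | n x y. \<forall>i<n. x i \<in> vcarrier X \<and> y i \<in> vcarrier Y},
      vzero = (\<lambda>_. 0),
      vadd = (\<lambda>u v B. u B + v B),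
      vscale = (\<lambda>a u B. a * u B),
      vnorm = projective_norm X Y\<rparr>"

text \<open>The completion of a normed space: classes of Cauchy sequences modulo null sequences.\<close>

definition cauchy_seqs :: "('k::real_or_complex, 'v) nspace \<Rightarrow> (nat \<Rightarrow> 'v) set" where
  "cauchy_seqs V = {\<sigma>. (\<forall>n. \<sigma> n \<in> vcarrier V) \<and>
     (\<forall>e>0. \<exists>N. \<forall>n\<ge>N. \<forall>m\<ge>N. vdist V (\<sigma> n) (\<sigma> m) < e)}"

definition cauchy_rel :: "('k::real_or_complex, 'v) nspace \<Rightarrow> ((nat \<Rightarrow> 'v) \<times> (nat \<Rightarrow> 'v)) set" where
  "cauchy_rel V = {(\<sigma>, \<tau>). \<sigma> \<in> cauchy_seqs V \<and> \<tau> \<in> cauchy_seqs V \<and>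
     (\<lambda>n. vdist V (\<sigma> n) (\<tau> n)) \<longlonglongrightarrow> 0}"

definition nspace_completion ::
    "('k::real_or_complex, 'v) nspace \<Rightarrow> ('k, (nat \<Rightarrow> 'v) set) nspace" where
  "nspace_completion V =
     \<lparr>vcarrier = cauchy_seqs V // cauchy_rel V,
      vzero = cauchy_rel V `` {\<lambda>_. vzero V},
      vadd = (\<lambda>S T. cauchy_rel V `` {\<lambda>n. vadd V ((SOME \<sigma>. \<sigma> \<in> S) n) ((SOME \<tau>. \<tau> \<in> T) n)}),
      vscale = (\<lambda>a S. cauchy_rel V `` {\<lambda>n. vscale V a ((SOME \<sigma>. \<sigma> \<in> S) n)}),
      vnorm = (\<lambda>S. lim (\<lambda>n. vnorm V ((SOME \<sigma>. \<sigma> \<in> S) n)))\<rparr>"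

definition completion_embed :: "('k::real_or_complex, 'v) nspace \<Rightarrow> 'v \<Rightarrow> (nat \<Rightarrow> 'v) set" where
  "completion_embed V v = cauchy_rel V `` {\<lambda>_. v}"

abbreviation projective_tensor ::
    "('k::real_or_complex, 'x) nspace \<Rightarrow> ('k, 'y) nspace \<Rightarrow>
     ('k, (nat \<Rightarrow> ('k, 'x, 'y) tensor) set) nspace" where
  "projective_tensor X Y \<equiv> nspace_completion (algebraic_tensor X Y)"

definition attains_projective_norm ::
    "('k::real_or_complex, 'x) nspace \<Rightarrow> ('k, 'y) nspace \<Rightarrow>
     (nat \<Rightarrow> ('k, 'x, 'y) tensor) set \<Rightarrow> bool" where
  "attains_projective_norm X Y u \<longleftrightarrow>
     (\<exists>x y. (\<forall>i. x i \<in> vcarrier X) \<and> (\<forall>i. y i \<in> vcarrier Y) \<and>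
        limitin (norm_topology (projective_tensor X Y))
          (\<lambda>n. completion_embed (algebraic_tensor X Y) (tensor_sum X Y n x y)) u sequentially \<and>
        (\<lambda>i. vnorm X (x i) * vnorm Y (y i)) sums vnorm (projective_tensor X Y) u)"

definition NA_projective ::
    "('k::real_or_complex, 'x) nspace \<Rightarrow> ('k, 'y) nspace \<Rightarrow>
     (nat \<Rightarrow> ('k, 'x, 'y) tensor) set set" where
  "NA_projective X Y =
     {u \<in> vcarrier (projective_tensor X Y). attains_projective_norm X Y u}"

definition atom :: "'a measure \<Rightarrow> 'a set \<Rightarrow> bool" where
  "atom M A \<longleftrightarrow> A \<in> sets M \<and> 0 < emeasure M A \<and> emeasure M A < \<infinity> \<and>
     (\<forall>B\<in>sets M. B \<subseteq> A \<longrightarrow> emeasure M B = 0 \<or> emeasure M B = emeasure M A)"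

text \<open>\<open>\<C>\<close> represents the atoms contained in \<open>E\<close> modulo null sets; choosing countably many
  representatives keeps their union measurable.\<close>

definition purely_atomic_set :: "'a measure \<Rightarrow> 'a set \<Rightarrow> bool" where
  "purely_atomic_set M E \<longleftrightarrow>
     (\<exists>\<C>. countable \<C> \<and> (\<forall>A\<in>\<C>. atom M A \<and> A \<subseteq> E) \<and>
        (\<forall>A. atom M A \<and> A \<subseteq> E \<longrightarrow> (\<exists>C\<in>\<C>. sym_diff A C \<in> null_sets M)) \<and>
        sym_diff E (\<Union>\<C>) \<in> null_sets M)"

definition purely_atomic :: "'a measure \<Rightarrow> bool" where
  "purely_atomic M \<longleftrightarrow>
     (\<forall>E\<in>sets M. 0 < emeasure M E \<and> emeasure M E < \<infinity> \<longrightarrow> purely_atomic_set M E)"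

end

theory Submission
  imports Defs
begin

text \<open>Via \<open>f \<otimes> y \<mapsto> (\<omega> \<mapsto> f(\<omega>) y)\<close> the projective norm dominates the norm of \<open>L\<^sub>1(\<mu>, Y)\<close>, with
  equality for tensors that are limits of simple functions. If \<open>Y\<close> is strictly convex and
  \<open>v = \<Sum> f\<^sub>i \<otimes> y\<^sub>i\<close> is an optimal representation, then almost everywhere \<open>v(\<omega>)\<close> lies on one of
  the countably many lines through the \<open>y\<^sub>i\<close>. For linearly independent \<open>e\<^sub>1, e\<^sub>2\<close> and a set \<open>E\<close> of
  finite measure, \<open>g \<otimes> e\<^sub>1 + 1\<^sub>E \<otimes> e\<^sub>2\<close> therefore attains its norm whenever \<open>g\<close> takes finitely
  many values, but only if \<open>g\<close> is almost everywhere countably valued on \<open>E\<close>.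

  If \<open>\<mu>\<close> is not purely atomic, some \<open>E\<close> of positive finite measure contains no atom, and there are
  \<open>A\<^sub>n \<subseteq> E\<close> such that prescribing membership in all \<open>A\<^sub>n\<close> leaves only a null set. Suppose the
  norm-attaining tensors were the intersection of open sets \<open>U\<^sub>n\<close>. Put \<open>g = \<Sum> \<epsilon>\<^sub>n 1\<^bsub>A n\<^esub>\<close> with
  rapidly decreasing \<open>\<epsilon>\<^sub>n > 0\<close>, so that all level sets of \<open>g\<close> are null; choosing the \<open>\<epsilon>\<^sub>n\<close>
  successively small enough puts the tensor of \<open>g\<close> into every \<open>U\<^sub>n\<close>, a contradiction.\<close>

section \<open>Atomless sets\<close>

text \<open>Exhaustion: take a countable family of atoms in \<open>E\<close> whose union has the
  largest possible measure. If every non-null measurable subset of \<open>E\<close> contained an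
  atom, the part of \<open>E\<close> outside the union would be null, because an atom in it would
  enlarge the union; this family would then make \<open>E\<close> purely atomic.\<close>

lemma atomless_subset_of_not_purely_atomic_set:
  assumes E: "E \<in> sets M" "emeasure M E < \<infinity>" "\<not> purely_atomic_set M E"
  shows "\<exists>F\<in>sets M. F \<subseteq> E \<and> 0 < emeasure M F \<and> (\<forall>A\<subseteq>F. \<not> atom M A)"
proof (rule ccontr)
  assume nt: "\<not> ?thesis"
  have ex: "\<exists>A. A \<subseteq> F \<and> atom M A" if F: "F \<in> sets M" "F \<subseteq> E" "0 < emeasure M F" for F
    using F nt by blast
  define \<A> where "\<A> = {\<C>. countable \<C> \<and> (\<forall>A\<in>\<C>. atom M A \<and> A \<subseteq> E)}"
  define s where "s = (SUP \<C>\<in>\<A>. emeasure M (\<Union>\<C>))"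
  have "{} \<in> \<A>" by (simp add: \<A>_def)
  then have "(\<lambda>\<C>. emeasure M (\<Union>\<C>)) ` \<A> \<noteq> {}" by blast
  from ennreal_Sup_countable_SUP[OF this] obtain f :: "nat \<Rightarrow> ennreal"
    where f: "range f \<subseteq> (\<lambda>\<C>. emeasure M (\<Union>\<C>)) ` \<A>" "s = (SUP i. f i)"
    unfolding s_def by auto
  then have "\<forall>i. \<exists>\<C>\<in>\<A>. f i = emeasure M (\<Union>\<C>)" by auto
  then obtain D where D: "\<And>i. D i \<in> \<A>" "\<And>i. f i = emeasure M (\<Union>(D i))" by metis
  \<comment> \<open>The supremum is attained, since a maximising sequence of countable families has
    a countable union.\<close>
  define \<C> where "\<C> = (\<Union>i. D i)"
  have C: "\<C> \<in> \<A>" using D(1) by (auto simp: \<C>_def \<A>_def)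
  have meas: "\<Union>\<B> \<in> sets M" if "\<B> \<in> \<A>" for \<B>
    using that by (intro sets.countable_Union) (auto simp: \<A>_def atom_def)
  have sC: "s \<le> emeasure M (\<Union>\<C>)" unfolding f(2) D(2)
    by (intro SUP_least emeasure_mono) (use meas[OF C] in \<open>auto simp: \<C>_def\<close>)
  have CE: "\<Union>\<C> \<subseteq> E" using C by (auto simp: \<A>_def)
  have null: "emeasure M (E - \<Union>\<C>) = 0"
  proof (rule ccontr)
    assume "emeasure M (E - \<Union>\<C>) \<noteq> 0"
    then obtain A where A: "A \<subseteq> E - \<Union>\<C>" "atom M A"
      using ex[of "E - \<Union>\<C>"] meas[OF C] E(1) by (auto simp: zero_less_iff_neq_zero)
    have "insert A \<C> \<in> \<A>" using A C by (auto simp: \<A>_def)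
    then have "emeasure M (\<Union>(insert A \<C>)) \<le> s" unfolding s_def by (rule SUP_upper)
    moreover have "emeasure M (\<Union>(insert A \<C>)) = emeasure M A + emeasure M (\<Union>\<C>)"
      using A meas[OF C] by (subst plus_emeasure) (auto simp: atom_def)
    moreover have fin: "emeasure M (\<Union>\<C>) < \<infinity>"
      using emeasure_mono[OF CE E(1)] E(2) by (rule le_less_trans)
    moreover have pos: "0 < emeasure M A" using A by (simp add: atom_def)
    ultimately have "emeasure M A + emeasure M (\<Union>\<C>) \<le> s" by simp
    from order_trans[OF this sC]
    have "emeasure M (\<Union>\<C>) + emeasure M A \<le> emeasure M (\<Union>\<C>) + 0" by (simp add: add.commute)
    then show False using pos fin
      unfolding ennreal_add_left_cancel_le by auto
  qed
  have "purely_atomic_set M E" unfolding purely_atomic_set_def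
  proof (intro exI[of _ \<C>] conjI allI impI)
    show "countable \<C>" "\<forall>A\<in>\<C>. atom M A \<and> A \<subseteq> E" using C by (auto simp: \<A>_def)
    have "sym_diff E (\<Union>\<C>) = E - \<Union>\<C>" using CE by auto
    then show "sym_diff E (\<Union>\<C>) \<in> null_sets M" using null meas[OF C] E(1) by (auto simp: null_sets_def)
    fix A assume A: "atom M A \<and> A \<subseteq> E"
    then have Am: "A \<in> sets M" by (simp add: atom_def)
    have Cm: "C \<in> sets M" if "C \<in> \<C>" for C using C that by (auto simp: \<A>_def atom_def)
    \<comment> \<open>Otherwise \<open>A\<close> would be covered by countably many null
      intersections and the null remainder of \<open>E\<close>.\<close>
    have "\<exists>C\<in>\<C>. emeasure M (A \<inter> C) \<noteq> 0"
    proof (rule ccontr)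
      assume "\<not> ?thesis"
      then have "(\<Union>C\<in>\<C>. A \<inter> C) \<in> null_sets M"
        using C Cm Am by (intro null_sets_UN') (auto simp: \<A>_def null_sets_def)
      moreover have "E - \<Union>\<C> \<in> null_sets M" using null meas[OF C] E(1) by (auto simp: null_sets_def)
      ultimately have "(\<Union>C\<in>\<C>. A \<inter> C) \<union> (E - \<Union>\<C>) \<in> null_sets M" by (rule null_sets.Un)
      then have "A \<in> null_sets M" using Am A by (elim null_sets_subset) auto
      then show False using A by (auto simp: atom_def null_sets_def)
    qed
    then obtain C' where C': "C' \<in> \<C>" "emeasure M (A \<inter> C') \<noteq> 0" by blast
    then have at: "atom M C'" using C by (auto simp: \<A>_def)
    \<comment> \<open>Two atoms with a non-null intersection both have the measure of that
      intersection; as it is finite, their symmetric difference is null.\<close>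
    have "emeasure M (A \<inter> C') = emeasure M A" "emeasure M (A \<inter> C') = emeasure M C'"
      using A at C' Am Cm[OF C'(1)] by (auto simp: atom_def)
    then have "emeasure M (A - A \<inter> C') = 0" "emeasure M (C' - A \<inter> C') = 0"
      using A at Am Cm[OF C'(1)] by (subst emeasure_Diff; auto simp: atom_def)+
    then have "(A - A \<inter> C') \<union> (C' - A \<inter> C') \<in> null_sets M"
      using Am Cm[OF C'(1)] by (intro null_sets.Un) (auto simp: null_sets_def)
    moreover have "(A - A \<inter> C') \<union> (C' - A \<inter> C') = sym_diff A C'" by blast
    ultimately show "\<exists>C\<in>\<C>. sym_diff A C \<in> null_sets M" using C'(1) by auto
  qed
  then show False using E(3) by blast
qed

text \<open>Each cell is split so as to lose, up to a factor 2, as much measure as possible. A decreasing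
  chain of cells with a non-null intersection would lose a fixed amount in every step, because
  that intersection itself can be split.\<close>

lemma atomless_separating_sets:
  assumes E: "E \<in> sets M" "emeasure M E < \<infinity>" and na: "\<And>A. A \<subseteq> E \<Longrightarrow> \<not> atom M A"
  obtains A :: "nat \<Rightarrow> 'a set" where "\<And>n. A n \<in> sets M" "\<And>n. A n \<subseteq> E"
    "\<And>\<omega>. \<omega> \<in> E \<Longrightarrow> \<exists>N\<in>null_sets M. {\<omega>'\<in>E. \<forall>n. \<omega>' \<in> A n \<longleftrightarrow> \<omega> \<in> A n} \<subseteq> N"
proof -
  let ?m = "measure M"
  have fin: "emeasure M F < \<infinity>" if "F \<subseteq> E" for F
    using emeasure_mono[OF that E(1)] E(2) by (rule le_less_trans)
  have fm: "F \<in> fmeasurable M" if "F \<in> sets M" "F \<subseteq> E" for F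
    using fin[OF that(2)] that(1) by (auto simp: fmeasurable_def)
  \<comment> \<open>\<open>q G B\<close> is the measure lost for certain when \<open>G\<close> is
    replaced by one of its two halves. The supremum over \<open>B\<close> need not be attained,
    hence the factor 2 in \<open>good\<close>.\<close>
  define q where "q G B = min (?m B) (?m (G - B))" for G B
  define good where "good G B \<longleftrightarrow> B \<in> sets M \<and> B \<subseteq> G \<and>
    (\<forall>B'\<in>sets M. B' \<subseteq> G \<longrightarrow> q G B' \<le> 2 * q G B)" for G B
  have "\<exists>B. good G B" if G: "G \<in> sets M" "G \<subseteq> E" for G
  proof (cases "\<exists>B'\<in>sets M. B' \<subseteq> G \<and> 0 < q G B'")
    case True
    define Q where "Q = q G ` {B'\<in>sets M. B' \<subseteq> G}"
    have bdd: "bdd_above Q" unfolding Q_def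
    proof (rule bdd_aboveI2)
      fix B assume "B \<in> {B'\<in>sets M. B' \<subseteq> G}"
      then show "q G B \<le> ?m G"
        using measure_mono_fmeasurable[of B G M] fm[OF G] by (auto simp: q_def)
    qed
    have "0 < Sup Q" using True less_cSup_iff[OF _ bdd] by (force simp: Q_def)
    then have "Sup Q / 2 < Sup Q" by simp
    moreover have "Q \<noteq> {}" using True by (auto simp: Q_def)
    ultimately have "\<exists>y\<in>Q. Sup Q / 2 < y" using less_cSup_iff[OF _ bdd] by blast
    then obtain B where B: "B \<in> sets M" "B \<subseteq> G" "Sup Q / 2 < q G B"
      unfolding Q_def by blast
    have "q G B' \<le> 2 * q G B" if "B' \<in> sets M" "B' \<subseteq> G" for B'
    proof -
      have "q G B' \<le> Sup Q" using that by (intro cSup_upper bdd) (auto simp: Q_def)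
      then show ?thesis using B(3) by simp
    qed
    then show ?thesis using B by (auto simp: good_def)
  next
    case False
    then have "good G {}" by (auto simp: good_def q_def not_less)
    then show ?thesis ..
  qed
  then obtain H where H: "\<And>G. G \<in> sets M \<Longrightarrow> G \<subseteq> E \<Longrightarrow> good G (H G)" by metis
  \<comment> \<open>For \<open>\<omega>\<close> in \<open>E\<close> this is the cell of depth
    \<open>n\<close> around \<open>\<omega>\<close>; a point outside \<open>E\<close> follows the
    complements, so every value is a cell.\<close>
  define c where "c \<omega> n = rec_nat E (\<lambda>_ G. if \<omega> \<in> H G then H G else G - H G) n" for \<omega> n
  have c0: "c \<omega> 0 = E" and cS: "c \<omega> (Suc n) = (if \<omega> \<in> H (c \<omega> n) then H (c \<omega> n) else c \<omega> n - H (c \<omega> n))"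
    for \<omega> n by (simp_all add: c_def)
  have c: "c \<omega> n \<in> sets M" "c \<omega> n \<subseteq> E" for \<omega> n
  proof (induction n)
    case 0 { case 1 show ?case using E by (simp add: c0) next case 2 show ?case by (simp add: c0) }
  next
    case (Suc n)
    note g = H[OF Suc]
    { case 1 show ?case using g Suc by (auto simp: cS good_def)
    next case 2 show ?case using g Suc by (auto simp: cS good_def) }
  qed
  have Hc: "H (c \<omega> n) \<in> sets M" "H (c \<omega> n) \<subseteq> c \<omega> n" for \<omega> n
    using H[OF c[of \<omega> n]] by (auto simp: good_def)
  have self: "\<omega> \<in> c \<omega> n" if "\<omega> \<in> E" for \<omega> n
    using that by (induction n) (auto simp: c0 cS)
  have cell_eq: "\<omega>' \<in> c \<omega> n \<Longrightarrow> c \<omega>' n = c \<omega> n" for \<omega> \<omega>' n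
  proof (induction n)
    case (Suc n)
    then have "\<omega>' \<in> c \<omega> n" using Hc(2)[of \<omega> n] by (auto simp: cS split: if_splits)
    with Suc.IH have "c \<omega>' n = c \<omega> n" .
    with Suc.prems show ?case by (auto simp: cS split: if_splits)
  qed (simp add: c0)
  have fin_cells: "finite (range (\<lambda>\<omega>. c \<omega> n))" for n
  proof (induction n)
    case (Suc n)
    have "range (\<lambda>\<omega>. c \<omega> (Suc n)) \<subseteq> H ` range (\<lambda>\<omega>. c \<omega> n) \<union> (\<lambda>G. G - H G) ` range (\<lambda>\<omega>. c \<omega> n)"
      by (auto simp: cS)
    then show ?case by (rule finite_subset) (use Suc in blast)
  qed (simp add: c0)
  \<comment> \<open>Membership in \<open>A n\<close> records which half is taken at step
    \<open>n\<close>. There are only finitely many cells of depth \<open>n\<close>, so the chosen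
    halves have a measurable union.\<close>
  define A where "A n = \<Union>(H ` range (\<lambda>\<omega>. c \<omega> n))" for n
  have A_iff: "\<omega> \<in> A n \<longleftrightarrow> \<omega> \<in> H (c \<omega> n)" for \<omega> n
  proof
    assume "\<omega> \<in> A n"
    then obtain \<omega>' where "\<omega> \<in> H (c \<omega>' n)" by (auto simp: A_def)
    moreover from this have "c \<omega> n = c \<omega>' n" using Hc(2) by (intro cell_eq) auto
    ultimately show "\<omega> \<in> H (c \<omega> n)" by simp
  qed (auto simp: A_def)
  show thesis
  proof (rule that)
    show "A n \<in> sets M" for n unfolding A_def
      using fin_cells Hc(1) by (intro sets.finite_Union) auto
    show "A n \<subseteq> E" for n using Hc(2) c(2) by (fastforce simp: A_def)
    fix \<omega> assume "\<omega> \<in> E"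
    define L where "L = (\<Inter>n. c \<omega> n)"
    have L: "L \<in> sets M" "L \<subseteq> E" unfolding L_def using c(1) c(2)[of \<omega> 0] by (auto intro: sets.countable_INT')
    have "emeasure M L = 0"
    proof (rule ccontr)
      assume pos: "emeasure M L \<noteq> 0"
      obtain B where B: "B \<in> sets M" "B \<subseteq> L" "emeasure M B \<noteq> 0" "emeasure M B \<noteq> emeasure M L"
        using na[OF L(2)] pos L fin[OF L(2)] by (auto simp: atom_def zero_less_iff_neq_zero)
      define \<delta> where "\<delta> = min (?m B) (?m (L - B))"
      have BE: "B \<subseteq> E" using B L by auto
      have "?m B > 0" using B(3) fin[OF BE]
        by (metis emeasure_eq_ennreal_measure ennreal_0 infinity_ennreal_def less_irrefl zero_less_measure_iff)
      moreover have "?m (L - B) = ?m L - ?m B"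
        using fin[OF L(2)] L B by (intro measure_Diff) auto
      moreover have "?m B \<le> ?m L" using B L by (intro measure_mono_fmeasurable fm) auto
      moreover have "?m B \<noteq> ?m L" using B(4) fin[OF BE] fin[OF L(2)] 
        by (metis emeasure_eq_ennreal_measure infinity_ennreal_def less_irrefl)
      ultimately have \<delta>: "\<delta> > 0" by (simp add: \<delta>_def)
      \<comment> \<open>\<open>B\<close> also splits every cell around \<open>L\<close> into parts
        of measure at least \<open>\<delta>\<close>, and the chosen split does at least half as
        well.\<close>
      have step: "?m (c \<omega> (Suc n)) \<le> ?m (c \<omega> n) - \<delta> / 2" for n
      proof -
        let ?G = "c \<omega> n"
        have Bn: "B \<subseteq> ?G" "L \<subseteq> ?G" using B(2) by (auto simp: L_def)
        have "?m (L - B) \<le> ?m (?G - B)"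
          using Bn L B c[of \<omega> n] by (intro measure_mono_fmeasurable fm) auto
        then have "\<delta> \<le> q ?G B" by (auto simp: \<delta>_def q_def)
        also have "\<dots> \<le> 2 * q ?G (H ?G)" using H[OF c[of \<omega> n]] B(1) Bn(1) by (auto simp: good_def)
        finally have "\<delta> / 2 \<le> ?m (H ?G)" "\<delta> / 2 \<le> ?m (?G - H ?G)" by (auto simp: q_def)
        moreover have "?m (?G - H ?G) = ?m ?G - ?m (H ?G)"
          using Hc[of \<omega> n] c[of \<omega> n] fin[OF c(2)[of \<omega> n]] by (intro measure_Diff) auto
        ultimately show ?thesis by (auto simp: cS)
      qed
      have "?m (c \<omega> n) \<le> ?m E - n * (\<delta> / 2)" for n
      proof (induction n)
        case (Suc n) then show ?case using step[of n] by (simp add: algebra_simps add_divide_distrib)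
      qed (simp add: c0)
      moreover obtain n :: nat where "?m E < n * (\<delta> / 2)"
        using ex_less_of_nat_mult[of "\<delta>/2" "?m E"] \<delta> by auto
      ultimately show False using measure_nonneg[of M "c \<omega> n"] by (smt (verit))
    qed
    then have "L \<in> null_sets M" using L by (auto simp: null_sets_def)
    moreover have "\<omega>' \<in> L" if w: "\<omega>' \<in> E" "\<forall>n. \<omega>' \<in> A n \<longleftrightarrow> \<omega> \<in> A n" for \<omega>'
    proof -
      \<comment> \<open>Equal membership in all \<open>A n\<close> means equal cells at every depth,
        which puts \<open>\<omega>'\<close> into \<open>L\<close>.\<close>
      have "c \<omega>' n = c \<omega> n" for n
      proof (induction n)
        case (Suc n)
        then show ?case using w(2)[rule_format, of n] by (simp add: cS A_iff)
      qed (simp add: c0)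
      then show ?thesis using self[OF w(1)] by (auto simp: L_def)
    qed
    ultimately show "\<exists>N\<in>null_sets M. {\<omega>'\<in>E. \<forall>n. \<omega>' \<in> A n \<longleftrightarrow> \<omega> \<in> A n} \<subseteq> N" by blast
  qed
qed

section \<open>Completions of seminormed spaces of functions\<close>

text \<open>These properties of the algebraic tensor product suffice to compute in its completion.
  Vectors are functions with pointwise operations, so vector identities reduce to scalar ones.
  Scaling is an inequality because that is what an infimum over representations yields
  directly.\<close>

locale seminormed_functions =
  fixes V :: "('k::real_or_complex, 'b \<Rightarrow> 'k) nspace"
  assumes vadd_eq: "vadd V = (\<lambda>u v b. u b + v b)"
    and vscale_eq: "vscale V = (\<lambda>a u b. a * u b)"
    and vadd_closed: "u \<in> vcarrier V \<Longrightarrow> v \<in> vcarrier V \<Longrightarrow> vadd V u v \<in> vcarrier V"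
    and vscale_closed: "u \<in> vcarrier V \<Longrightarrow> vscale V a u \<in> vcarrier V"
    and vnorm_nonneg: "u \<in> vcarrier V \<Longrightarrow> 0 \<le> vnorm V u"
    and vnorm_triangle: "u \<in> vcarrier V \<Longrightarrow> v \<in> vcarrier V \<Longrightarrow>
      vnorm V (vadd V u v) \<le> vnorm V u + vnorm V v"
    and vnorm_scale_le: "u \<in> vcarrier V \<Longrightarrow> vnorm V (vscale V a u) \<le> norm a * vnorm V u"
begin

abbreviation "\<C> \<equiv> nspace_completion V"
abbreviation cls :: "(nat \<Rightarrow> 'b \<Rightarrow> 'k) \<Rightarrow> (nat \<Rightarrow> 'b \<Rightarrow> 'k) set" where
  "cls \<sigma> \<equiv> cauchy_rel V `` {\<sigma>}"

lemma vdist_eq: "vdist V u v = vnorm V (\<lambda>b. u b - v b)"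
  by (simp add: vdist_def vadd_eq vscale_eq)

lemma diff_closed: "u \<in> vcarrier V \<Longrightarrow> v \<in> vcarrier V \<Longrightarrow> (\<lambda>b. u b - v b) \<in> vcarrier V"
  using vadd_closed[OF _ vscale_closed[of v "-1"], of u] by (simp add: vadd_eq vscale_eq)

lemma vdist_nonneg: "u \<in> vcarrier V \<Longrightarrow> v \<in> vcarrier V \<Longrightarrow> 0 \<le> vdist V u v"
  by (simp add: vdist_eq diff_closed vnorm_nonneg)

lemma vdist_self: "u \<in> vcarrier V \<Longrightarrow> vdist V u u = 0"
  using vnorm_scale_le[of u 0] vdist_nonneg[of u u] by (simp add: vdist_eq vscale_eq)

lemma vdist_commute_le:
  assumes "u \<in> vcarrier V" "v \<in> vcarrier V" shows "vdist V u v \<le> vdist V v u"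
  using vnorm_scale_le[OF diff_closed[OF assms(2,1)], of "-1"] by (simp add: vdist_eq vscale_eq)

lemma vdist_commute: "u \<in> vcarrier V \<Longrightarrow> v \<in> vcarrier V \<Longrightarrow> vdist V u v = vdist V v u"
  by (intro antisym vdist_commute_le)

lemma vdist_triangle:
  assumes "u \<in> vcarrier V" "v \<in> vcarrier V" "w \<in> vcarrier V"
  shows "vdist V u w \<le> vdist V u v + vdist V v w"
  using vnorm_triangle[OF diff_closed[OF assms(1,2)] diff_closed[OF assms(2,3)]]
  by (simp add: vdist_eq vadd_eq)

lemma vnorm_diff_le:
  assumes "u \<in> vcarrier V" "v \<in> vcarrier V" shows "\<bar>vnorm V u - vnorm V v\<bar> \<le> vdist V u v"
  using vnorm_triangle[OF diff_closed[OF assms] assms(2)]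
    vnorm_triangle[OF diff_closed[OF assms(2,1)] assms(1)] vdist_commute[OF assms]
  by (simp add: vdist_eq vadd_eq abs_le_iff)

lemma vdist_add_le:
  assumes "u \<in> vcarrier V" "v \<in> vcarrier V" "u' \<in> vcarrier V" "v' \<in> vcarrier V"
  shows "vdist V (vadd V u v) (vadd V u' v') \<le> vdist V u u' + vdist V v v'"
  using vnorm_triangle[OF diff_closed[OF assms(1,3)] diff_closed[OF assms(2,4)]]
  by (simp add: vdist_eq vadd_eq algebra_simps)

lemma vdist_scale_le:
  assumes "u \<in> vcarrier V" "v \<in> vcarrier V"
  shows "vdist V (vscale V a u) (vscale V a v) \<le> norm a * vdist V u v"
  using vnorm_scale_le[OF diff_closed[OF assms], of a]
  by (simp add: vdist_eq vscale_eq right_diff_distrib)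

lemma cauchy_seqsD: "\<sigma> \<in> cauchy_seqs V \<Longrightarrow> \<sigma> n \<in> vcarrier V"
  by (simp add: cauchy_seqs_def)

lemma cauchy_seqs_const: "u \<in> vcarrier V \<Longrightarrow> (\<lambda>_. u) \<in> cauchy_seqs V"
  by (auto simp: cauchy_seqs_def vdist_self)

lemma cauchy_seqs_scale:
  assumes \<sigma>: "\<sigma> \<in> cauchy_seqs V" shows "(\<lambda>n. vscale V a (\<sigma> n)) \<in> cauchy_seqs V"
  unfolding cauchy_seqs_def
proof (intro CollectI conjI allI impI)
  show "vscale V a (\<sigma> n) \<in> vcarrier V" for n by (intro vscale_closed cauchy_seqsD \<sigma>)
  fix e :: real assume "e > 0"
  \<comment> \<open>The summand 1 keeps the divisor positive when \<open>a = 0\<close>.\<close>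
  then have "e / (norm a + 1) > 0" by (intro divide_pos_pos add_nonneg_pos) auto
  then obtain N where N: "\<forall>n\<ge>N. \<forall>m\<ge>N. vdist V (\<sigma> n) (\<sigma> m) < e / (norm a + 1)"
    using \<sigma> by (auto simp: cauchy_seqs_def)
  show "\<exists>N. \<forall>n\<ge>N. \<forall>m\<ge>N. vdist V (vscale V a (\<sigma> n)) (vscale V a (\<sigma> m)) < e"
  proof (intro exI[of _ N] allI impI)
    fix n m assume "n \<ge> N" "m \<ge> N"
    then have *: "vdist V (\<sigma> n) (\<sigma> m) < e / (norm a + 1)" using N by blast
    have "vdist V (vscale V a (\<sigma> n)) (vscale V a (\<sigma> m)) \<le> norm a * vdist V (\<sigma> n) (\<sigma> m)"
      by (intro vdist_scale_le cauchy_seqsD \<sigma>)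
    also have "\<dots> \<le> (norm a + 1) * vdist V (\<sigma> n) (\<sigma> m)"
      using vdist_nonneg[OF cauchy_seqsD[OF \<sigma>] cauchy_seqsD[OF \<sigma>]] by (simp add: mult_right_mono)
    also have "\<dots> < e" using * by (simp add: pos_less_divide_eq add_nonneg_pos mult.commute)
    finally show "vdist V (vscale V a (\<sigma> n)) (vscale V a (\<sigma> m)) < e" .
  qed
qed

lemma cauchy_seqs_add:
  assumes \<sigma>: "\<sigma> \<in> cauchy_seqs V" and \<tau>: "\<tau> \<in> cauchy_seqs V"
  shows "(\<lambda>n. vadd V (\<sigma> n) (\<tau> n)) \<in> cauchy_seqs V"
  unfolding cauchy_seqs_def
proof (intro CollectI conjI allI impI)
  show "vadd V (\<sigma> n) (\<tau> n) \<in> vcarrier V" for n by (intro vadd_closed cauchy_seqsD \<sigma> \<tau>)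
  fix e :: real assume "e > 0"
  then have "e / 2 > 0" by simp
  then obtain N N' where N: "\<forall>n\<ge>N. \<forall>m\<ge>N. vdist V (\<sigma> n) (\<sigma> m) < e / 2"
      "\<forall>n\<ge>N'. \<forall>m\<ge>N'. vdist V (\<tau> n) (\<tau> m) < e / 2"
    using \<sigma> \<tau> unfolding cauchy_seqs_def by blast
  show "\<exists>N. \<forall>n\<ge>N. \<forall>m\<ge>N. vdist V (vadd V (\<sigma> n) (\<tau> n)) (vadd V (\<sigma> m) (\<tau> m)) < e"
  proof (intro exI[of _ "max N N'"] allI impI)
    fix n m assume "n \<ge> max N N'" "m \<ge> max N N'"
    then have "vdist V (\<sigma> n) (\<sigma> m) < e / 2" "vdist V (\<tau> n) (\<tau> m) < e / 2" using N by auto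
    then show "vdist V (vadd V (\<sigma> n) (\<tau> n)) (vadd V (\<sigma> m) (\<tau> m)) < e"
      using vdist_add_le[OF cauchy_seqsD[OF \<sigma>] cauchy_seqsD[OF \<tau>] cauchy_seqsD[OF \<sigma>] cauchy_seqsD[OF \<tau>],
          of n n m m] by simp
  qed
qed

lemma equiv_cauchy_rel: "equiv (cauchy_seqs V) (cauchy_rel V)"
proof (rule equivI)
  show "cauchy_rel V \<subseteq> cauchy_seqs V \<times> cauchy_seqs V" by (auto simp: cauchy_rel_def)
  show "refl_on (cauchy_seqs V) (cauchy_rel V)"
    by (auto simp: refl_on_def cauchy_rel_def vdist_self cauchy_seqsD)
  show "sym (cauchy_rel V)"
    by (auto simp: sym_def cauchy_rel_def vdist_commute cauchy_seqsD)
  show "trans (cauchy_rel V)"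
  proof (rule transI)
    fix \<sigma> \<tau> \<rho> assume a: "(\<sigma>, \<tau>) \<in> cauchy_rel V" "(\<tau>, \<rho>) \<in> cauchy_rel V"
    then have c: "\<sigma> n \<in> vcarrier V" "\<tau> n \<in> vcarrier V" "\<rho> n \<in> vcarrier V" for n
      by (auto simp: cauchy_rel_def cauchy_seqsD)
    have "(\<lambda>n. vdist V (\<sigma> n) (\<tau> n) + vdist V (\<tau> n) (\<rho> n)) \<longlonglongrightarrow> 0"
      using a by (auto simp: cauchy_rel_def intro: tendsto_add_zero)
    then have "(\<lambda>n. vdist V (\<sigma> n) (\<rho> n)) \<longlonglongrightarrow> 0"
      by (rule tendsto_0_le[of _ _ _ 1]) 
         (auto intro!: always_eventually simp: vdist_nonneg vdist_triangle c add_nonneg_nonneg)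
    then show "(\<sigma>, \<rho>) \<in> cauchy_rel V" using a by (auto simp: cauchy_rel_def)
  qed
qed

text \<open>The operations of the completion are defined through a chosen representative. Its
  equivalence to \<open>\<sigma>\<close> is what makes the formulas below independent of the
  choice.\<close>

lemma some_rep:
  assumes "\<sigma> \<in> cauchy_seqs V"
  shows "(\<sigma>, SOME \<tau>. \<tau> \<in> cls \<sigma>) \<in> cauchy_rel V"
proof -
  have "\<sigma> \<in> cls \<sigma>" using equiv_class_self[OF equiv_cauchy_rel assms] .
  then have "(SOME \<tau>. \<tau> \<in> cls \<sigma>) \<in> cls \<sigma>" by (rule someI[of "\<lambda>\<tau>. \<tau> \<in> cls \<sigma>"])
  then show ?thesis by simp
qed

lemma vcarrier_completion_iff: "S \<in> vcarrier \<C> \<longleftrightarrow> (\<exists>\<sigma>\<in>cauchy_seqs V. S = cls \<sigma>)"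
  by (auto simp: nspace_completion_def quotient_def)

text \<open>By the quadrilateral inequality the distances form a Cauchy sequence of reals.\<close>

lemma vdist_convergent:
  assumes \<sigma>: "\<sigma> \<in> cauchy_seqs V" and \<tau>: "\<tau> \<in> cauchy_seqs V"
  shows "convergent (\<lambda>n. vdist V (\<sigma> n) (\<tau> n))"
proof -
  have "Cauchy (\<lambda>n. vdist V (\<sigma> n) (\<tau> n))"
  proof (rule metric_CauchyI)
    fix e :: real assume "e > 0"
    then have "e / 2 > 0" by simp
    then obtain N N' where N: "\<forall>n\<ge>N. \<forall>m\<ge>N. vdist V (\<sigma> n) (\<sigma> m) < e / 2"
        "\<forall>n\<ge>N'. \<forall>m\<ge>N'. vdist V (\<tau> n) (\<tau> m) < e / 2"
      using \<sigma> \<tau> unfolding cauchy_seqs_def by blast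
    show "\<exists>M. \<forall>m\<ge>M. \<forall>n\<ge>M. dist (vdist V (\<sigma> m) (\<tau> m)) (vdist V (\<sigma> n) (\<tau> n)) < e"
    proof (intro exI[of _ "max N N'"] allI impI)
      fix m n assume mn: "m \<ge> max N N'" "n \<ge> max N N'"
      have 1: "vdist V (\<sigma> m) (\<tau> m) \<le> vdist V (\<sigma> m) (\<sigma> n) + vdist V (\<sigma> n) (\<tau> n) + vdist V (\<tau> n) (\<tau> m)" for m n
        using vdist_triangle[of "\<sigma> m" "\<sigma> n" "\<tau> m"] vdist_triangle[of "\<sigma> n" "\<tau> n" "\<tau> m"]
          cauchy_seqsD[OF \<sigma>] cauchy_seqsD[OF \<tau>] by simp
      have "vdist V (\<sigma> m) (\<sigma> n) < e / 2" "vdist V (\<sigma> n) (\<sigma> m) < e / 2"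
        "vdist V (\<tau> m) (\<tau> n) < e / 2" "vdist V (\<tau> n) (\<tau> m) < e / 2" using mn N by auto
      then show "dist (vdist V (\<sigma> m) (\<tau> m)) (vdist V (\<sigma> n) (\<tau> n)) < e"
        using 1[of m n] 1[of n m] by (simp add: dist_real_def abs_less_iff)
    qed
  qed
  then show ?thesis by (rule Cauchy_convergent)
qed

lemma vnorm_completion_tendsto:
  assumes \<sigma>: "\<sigma> \<in> cauchy_seqs V"
  shows "(\<lambda>n. vnorm V (\<sigma> n)) \<longlonglongrightarrow> vnorm \<C> (cls \<sigma>)"
proof -
  define \<rho> where "\<rho> = (SOME \<tau>. \<tau> \<in> cls \<sigma>)"
  have \<rho>: "(\<sigma>, \<rho>) \<in> cauchy_rel V" unfolding \<rho>_def by (rule some_rep[OF \<sigma>])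
  then have \<rho>c: "\<rho> \<in> cauchy_seqs V" and d: "(\<lambda>n. vdist V (\<sigma> n) (\<rho> n)) \<longlonglongrightarrow> 0"
    by (auto simp: cauchy_rel_def)
  \<comment> \<open>The norm is the distance to the multiple by 0.\<close>
  have "convergent (\<lambda>n. vnorm V (\<sigma> n))"
    using vdist_convergent[OF \<sigma> cauchy_seqs_scale[OF \<sigma>], of 0] by (simp add: vdist_eq vscale_eq)
  then obtain l where l: "(\<lambda>n. vnorm V (\<sigma> n)) \<longlonglongrightarrow> l" by (auto simp: convergent_def)
  have "(\<lambda>n. vnorm V (\<rho> n) - vnorm V (\<sigma> n)) \<longlonglongrightarrow> 0"
  proof (rule tendsto_0_le[OF d, of _ 1], rule always_eventually, rule allI)
    fix n
    show "norm (vnorm V (\<rho> n) - vnorm V (\<sigma> n)) \<le> norm (vdist V (\<sigma> n) (\<rho> n)) * 1"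
      using vnorm_diff_le[OF cauchy_seqsD[OF \<sigma>] cauchy_seqsD[OF \<rho>c], of n n] by simp
  qed
  from tendsto_add[OF this l] have "(\<lambda>n. vnorm V (\<rho> n)) \<longlonglongrightarrow> l" by simp
  then have "vnorm \<C> (cls \<sigma>) = l" by (simp add: nspace_completion_def \<rho>_def limI)
  with l show ?thesis by simp
qed

lemma vscale_completion:
  assumes \<sigma>: "\<sigma> \<in> cauchy_seqs V"
  shows "vscale \<C> a (cls \<sigma>) = cls (\<lambda>n. vscale V a (\<sigma> n))"
proof -
  define \<rho> where "\<rho> = (SOME \<tau>. \<tau> \<in> cls \<sigma>)"
  have \<rho>: "(\<sigma>, \<rho>) \<in> cauchy_rel V" unfolding \<rho>_def by (rule some_rep[OF \<sigma>])
  then have \<rho>c: "\<rho> \<in> cauchy_seqs V" and d: "(\<lambda>n. vdist V (\<sigma> n) (\<rho> n)) \<longlonglongrightarrow> 0"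
    by (auto simp: cauchy_rel_def)
  have "(\<lambda>n. vdist V (vscale V a (\<sigma> n)) (vscale V a (\<rho> n))) \<longlonglongrightarrow> 0"
  proof (rule tendsto_0_le[OF d, of _ "norm a"], rule always_eventually, rule allI)
    fix n
    note c = cauchy_seqsD[OF \<sigma>, of n] cauchy_seqsD[OF \<rho>c, of n]
    show "norm (vdist V (vscale V a (\<sigma> n)) (vscale V a (\<rho> n))) \<le> norm (vdist V (\<sigma> n) (\<rho> n)) * norm a"
      using vdist_scale_le[OF c, of a] vdist_nonneg[OF c] vdist_nonneg[OF vscale_closed[OF c(1)] vscale_closed[OF c(2)]]
      by (simp add: mult.commute)
  qed
  then have "cls (\<lambda>n. vscale V a (\<sigma> n)) = cls (\<lambda>n. vscale V a (\<rho> n))"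
    using cauchy_seqs_scale \<sigma> \<rho>c
    by (intro equiv_class_eq[OF equiv_cauchy_rel]) (simp add: cauchy_rel_def)
  then show ?thesis by (simp add: nspace_completion_def \<rho>_def)
qed

lemma vadd_completion:
  assumes \<sigma>: "\<sigma> \<in> cauchy_seqs V" and \<tau>: "\<tau> \<in> cauchy_seqs V"
  shows "vadd \<C> (cls \<sigma>) (cls \<tau>) = cls (\<lambda>n. vadd V (\<sigma> n) (\<tau> n))"
proof -
  define \<sigma>' where "\<sigma>' = (SOME \<rho>. \<rho> \<in> cls \<sigma>)"
  define \<tau>' where "\<tau>' = (SOME \<rho>. \<rho> \<in> cls \<tau>)"
  have r: "(\<sigma>, \<sigma>') \<in> cauchy_rel V" "(\<tau>, \<tau>') \<in> cauchy_rel V"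
    unfolding \<sigma>'_def \<tau>'_def by (intro some_rep \<sigma> \<tau>)+
  then have c: "\<sigma>' \<in> cauchy_seqs V" "\<tau>' \<in> cauchy_seqs V"
    and d: "(\<lambda>n. vdist V (\<sigma> n) (\<sigma>' n)) \<longlonglongrightarrow> 0" "(\<lambda>n. vdist V (\<tau> n) (\<tau>' n)) \<longlonglongrightarrow> 0"
    by (auto simp: cauchy_rel_def)
  have "(\<lambda>n. vdist V (vadd V (\<sigma> n) (\<tau> n)) (vadd V (\<sigma>' n) (\<tau>' n))) \<longlonglongrightarrow> 0"
  proof (rule tendsto_0_le[OF tendsto_add_zero[OF d], of _ 1], rule always_eventually, rule allI)
    fix n
    note k = cauchy_seqsD[OF \<sigma>, of n] cauchy_seqsD[OF \<tau>, of n] cauchy_seqsD[OF c(1), of n]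
      cauchy_seqsD[OF c(2), of n]
    show "norm (vdist V (vadd V (\<sigma> n) (\<tau> n)) (vadd V (\<sigma>' n) (\<tau>' n)))
        \<le> norm (vdist V (\<sigma> n) (\<sigma>' n) + vdist V (\<tau> n) (\<tau>' n)) * 1"
      using vdist_add_le[OF k] vdist_nonneg[OF vadd_closed[OF k(1,2)] vadd_closed[OF k(3,4)]]
      by simp
  qed
  then have "cls (\<lambda>n. vadd V (\<sigma> n) (\<tau> n)) = cls (\<lambda>n. vadd V (\<sigma>' n) (\<tau>' n))"
    using cauchy_seqs_add \<sigma> \<tau> c
    by (intro equiv_class_eq[OF equiv_cauchy_rel]) (simp add: cauchy_rel_def)
  then show ?thesis by (simp add: nspace_completion_def \<sigma>'_def \<tau>'_def)
qed

lemma vdist_completion_tendsto: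
  assumes \<sigma>: "\<sigma> \<in> cauchy_seqs V" and \<tau>: "\<tau> \<in> cauchy_seqs V"
  shows "(\<lambda>n. vdist V (\<sigma> n) (\<tau> n)) \<longlonglongrightarrow> vdist \<C> (cls \<sigma>) (cls \<tau>)"
  unfolding vdist_def vscale_completion[OF \<tau>] vadd_completion[OF \<sigma> cauchy_seqs_scale[OF \<tau>]]
  by (intro vnorm_completion_tendsto cauchy_seqs_add cauchy_seqs_scale \<sigma> \<tau>)

lemma vdist_completion_triangle:
  assumes "S \<in> vcarrier \<C>" "T \<in> vcarrier \<C>" "U \<in> vcarrier \<C>"
  shows "vdist \<C> S U \<le> vdist \<C> S T + vdist \<C> T U"
proof -
  obtain \<sigma> \<tau> \<rho> where *: "\<sigma> \<in> cauchy_seqs V" "\<tau> \<in> cauchy_seqs V" "\<rho> \<in> cauchy_seqs V"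
    and eq: "S = cls \<sigma>" "T = cls \<tau>" "U = cls \<rho>"
    using assms by (auto simp: vcarrier_completion_iff)
  show ?thesis unfolding eq
  proof (rule LIMSEQ_le[OF vdist_completion_tendsto tendsto_add[OF vdist_completion_tendsto vdist_completion_tendsto]])
    show "\<exists>N. \<forall>n\<ge>N. vdist V (\<sigma> n) (\<rho> n) \<le> vdist V (\<sigma> n) (\<tau> n) + vdist V (\<tau> n) (\<rho> n)"
      using * by (auto intro!: vdist_triangle cauchy_seqsD)
  qed (use * in auto)
qed

lemma openin_completion_ball:
  assumes "S \<in> vcarrier \<C>"
  shows "openin (norm_topology \<C>) {T \<in> vcarrier \<C>. vdist \<C> S T < r}"
  unfolding openin_norm_topology
proof (intro conjI ballI)
  fix T assume T: "T \<in> {T \<in> vcarrier \<C>. vdist \<C> S T < r}"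
  show "\<exists>r'>0. \<forall>U\<in>vcarrier \<C>. vdist \<C> T U < r' \<longrightarrow> U \<in> {T \<in> vcarrier \<C>. vdist \<C> S T < r}"
    using T vdist_completion_triangle[OF assms, of T]
    by (intro exI[of _ "r - vdist \<C> S T"]) fastforce
qed auto

lemma embed_in_carrier: "u \<in> vcarrier V \<Longrightarrow> completion_embed V u \<in> vcarrier \<C>"
  by (auto simp: vcarrier_completion_iff completion_embed_def intro: cauchy_seqs_const)

lemma vnorm_embed: "u \<in> vcarrier V \<Longrightarrow> vnorm \<C> (completion_embed V u) = vnorm V u"
  using LIMSEQ_unique[OF vnorm_completion_tendsto[OF cauchy_seqs_const] tendsto_const]
  by (simp add: completion_embed_def)

lemma vdist_embed:
  "u \<in> vcarrier V \<Longrightarrow> v \<in> vcarrier V \<Longrightarrow>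
    vdist \<C> (completion_embed V u) (completion_embed V v) = vdist V u v"
  using LIMSEQ_unique[OF vdist_completion_tendsto[OF cauchy_seqs_const cauchy_seqs_const] tendsto_const]
  by (simp add: completion_embed_def)

text \<open>Open balls around the limit turn topological convergence into convergence of distances,
  and these can be measured in \<open>V\<close> because the embedding is isometric.\<close>

lemma limitin_embedD:
  assumes lim: "limitin (norm_topology \<C>) (\<lambda>n. completion_embed V (v n)) (completion_embed V u) sequentially"
    and v: "\<And>n. v n \<in> vcarrier V" and u: "u \<in> vcarrier V"
  shows "(\<lambda>n. vdist V u (v n)) \<longlonglongrightarrow> 0"
proof (rule order_tendstoI)
  fix a :: real assume "a < 0"
  then show "\<forall>\<^sub>F n in sequentially. a < vdist V u (v n)"
    using vdist_nonneg[OF u v] by (intro always_eventually) (auto intro: less_le_trans)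
next
  fix r :: real assume "r > 0"
  then have "completion_embed V u \<in> {T \<in> vcarrier \<C>. vdist \<C> (completion_embed V u) T < r}"
    using u by (simp add: embed_in_carrier vdist_embed vdist_self)
  then have "\<forall>\<^sub>F n in sequentially.
      completion_embed V (v n) \<in> {T \<in> vcarrier \<C>. vdist \<C> (completion_embed V u) T < r}"
    using lim openin_completion_ball[OF embed_in_carrier[OF u]] unfolding limitin_def by blast
  then show "\<forall>\<^sub>F n in sequentially. vdist V u (v n) < r"
    by eventually_elim (simp add: u v vdist_embed)
qed

end

section \<open>The projective norm and the norm of vector-valued functions\<close>

lemma sum_lessThan_add:
  fixes f :: "nat \<Rightarrow> 'b::comm_monoid_add"
  shows "(\<Sum>i<n + m. f i) = (\<Sum>i<n. f i) + (\<Sum>i<m. f (n + i))"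
  by (induction m) (simp_all add: add.assoc)

section \<open>Representatives of classes in \<open>L1\<close>\<close>

abbreviation L1_class :: "'a measure \<Rightarrow> ('a \<Rightarrow> 'k::real_or_complex) \<Rightarrow> ('a \<Rightarrow> 'k) set" where
  "L1_class M f \<equiv> ae_rel M `` {f}"

lemma L1_class_eqI:
  "integrable M f \<Longrightarrow> integrable M g \<Longrightarrow> (AE \<omega> in M. f \<omega> = g \<omega>) \<Longrightarrow> L1_class M f = L1_class M g"
proof -
  assume a: "integrable M f" "integrable M g" "AE \<omega> in M. f \<omega> = g \<omega>"
  have "(AE \<omega> in M. f \<omega> = h \<omega>) \<longleftrightarrow> (AE \<omega> in M. g \<omega> = h \<omega>)" for h
    using a(3) by (intro eventually_subst) (auto elim: eventually_mono)
  then show ?thesis using a(1,2) by (simp add: ae_rel_def Image_singleton)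
qed

lemma some_L1_class:
  assumes "integrable M f"
  shows "integrable M (SOME g. g \<in> L1_class M f)"
    and "AE \<omega> in M. f \<omega> = (SOME g. g \<in> L1_class M f) \<omega>"
proof -
  define s where "s = (SOME g. g \<in> L1_class M f)"
  have "f \<in> L1_class M f" using assms by (simp add: ae_rel_def)
  then have "s \<in> L1_class M f" unfolding s_def by (rule someI[of "\<lambda>g. g \<in> L1_class M f"])
  then show "integrable M (SOME g. g \<in> L1_class M f)"
    "AE \<omega> in M. f \<omega> = (SOME g. g \<in> L1_class M f) \<omega>"
    unfolding s_def[symmetric] by (simp_all add: ae_rel_def)
qed

lemma vcarrier_L1_iff: "F \<in> vcarrier (L1 M) \<longleftrightarrow> (\<exists>f. integrable M f \<and> F = L1_class M f)"
  by (auto simp: L1_def quotient_def)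

lemma vnorm_L1:
  assumes "integrable M f"
  shows "vnorm (L1 M) (L1_class M f) = (\<integral>\<omega>. norm (f \<omega>) \<partial>M)"
proof -
  note s = some_L1_class[OF assms]
  have "(\<integral>\<omega>. norm ((SOME g. g \<in> L1_class M f) \<omega>) \<partial>M) = (\<integral>\<omega>. norm (f \<omega>) \<partial>M)"
  proof (rule integral_cong_AE)
    show "AE \<omega> in M. norm ((SOME g. g \<in> L1_class M f) \<omega>) = norm (f \<omega>)"
      using s(2) by eventually_elim simp
  qed (use s(1) assms in measurable)
  then show ?thesis by (simp add: L1_def)
qed

lemma vadd_L1:
  assumes "integrable M f" "integrable M g"
  shows "vadd (L1 M) (L1_class M f) (L1_class M g) = L1_class M (\<lambda>\<omega>. f \<omega> + g \<omega>)"
proof -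
  note s = some_L1_class[OF assms(1)] some_L1_class[OF assms(2)]
  have "L1_class M (\<lambda>\<omega>. (SOME f'. f' \<in> L1_class M f) \<omega> + (SOME f'. f' \<in> L1_class M g) \<omega>)
      = L1_class M (\<lambda>\<omega>. f \<omega> + g \<omega>)"
  proof (rule L1_class_eqI)
    show "AE \<omega> in M. (SOME f'. f' \<in> L1_class M f) \<omega> + (SOME f'. f' \<in> L1_class M g) \<omega> = f \<omega> + g \<omega>"
      using s(2,4) by eventually_elim simp
  qed (intro Bochner_Integration.integrable_add s(1,3) assms)+
  then show ?thesis by (simp add: L1_def)
qed

lemma vscale_L1:
  assumes "integrable M f"
  shows "vscale (L1 M) a (L1_class M f) = L1_class M (\<lambda>\<omega>. a * f \<omega>)"
proof -
  note s = some_L1_class[OF assms]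
  have "L1_class M (\<lambda>\<omega>. a * (SOME f'. f' \<in> L1_class M f) \<omega>) = L1_class M (\<lambda>\<omega>. a * f \<omega>)"
  proof (rule L1_class_eqI)
    show "AE \<omega> in M. a * (SOME f'. f' \<in> L1_class M f) \<omega> = a * f \<omega>"
      using s(2) by eventually_elim simp
  qed (intro integrable_mult_right s(1) assms)+
  then show ?thesis by (simp add: L1_def)
qed

lemma integrable_bounded_mult:
  fixes f w :: "'a \<Rightarrow> 'k::real_or_complex"
  assumes "integrable M f" "w \<in> borel_measurable M" "\<And>\<omega>. norm (w \<omega>) \<le> 1"
  shows "integrable M (\<lambda>\<omega>. w \<omega> * f \<omega>)"
proof (rule Bochner_Integration.integrable_bound[OF assms(1)])
  show "(\<lambda>\<omega>. w \<omega> * f \<omega>) \<in> borel_measurable M" using assms(1,2) by measurable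
  show "AE \<omega> in M. norm (w \<omega> * f \<omega>) \<le> norm (f \<omega>)"
    by (intro AE_I2) (simp add: norm_mult mult_left_le_one_le assms(3))
qed

section \<open>Finite tensors represented by integrable functions\<close>

locale L1_tensor = normed_space_over scl
  for scl :: "'k::real_or_complex \<Rightarrow> 'y::real_normed_vector \<Rightarrow> 'y" +
  fixes M :: "'a measure"
begin

abbreviation "X \<equiv> (L1 M :: ('k, ('a \<Rightarrow> 'k) set) nspace)"
abbreviation "Y \<equiv> nspace_of scl"

lemma nspace_of_simps [simp]:
  "vcarrier Y = UNIV" "vadd Y = (+)" "vscale Y = scl" "vnorm Y = norm"
  by (simp_all add: nspace_of_def)

text \<open>Tensors are written with functions instead of classes so that their values at a point
  can be formed.\<close>

definition tens :: "nat \<Rightarrow> (nat \<Rightarrow> 'a \<Rightarrow> 'k) \<Rightarrow> (nat \<Rightarrow> 'y) \<Rightarrow> ('k, ('a \<Rightarrow> 'k) set, 'y) tensor" where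
  "tens n f y = tensor_sum X Y n (\<lambda>i. L1_class M (f i)) y"

definition cost :: "nat \<Rightarrow> (nat \<Rightarrow> 'a \<Rightarrow> 'k) \<Rightarrow> (nat \<Rightarrow> 'y) \<Rightarrow> real" where
  "cost n f y = (\<Sum>i<n. (\<integral>\<omega>. norm (f i \<omega>) \<partial>M) * norm (y i))"

text \<open>The \<open>Y\<close>-valued function that corresponds to the tensor under the canonical
  map into the Bochner space of \<open>Y\<close>-valued integrable functions.\<close>

definition val :: "nat \<Rightarrow> (nat \<Rightarrow> 'a \<Rightarrow> 'k) \<Rightarrow> (nat \<Rightarrow> 'y) \<Rightarrow> 'a \<Rightarrow> 'y" where
  "val n f y \<omega> = (\<Sum>i<n. scl (f i \<omega>) (y i))"

text \<open>All terms of the sequence are included, also those beyond the length of the tensor, so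
  that the condition does not mention that length.\<close>

definition integrable_family :: "(nat \<Rightarrow> 'a \<Rightarrow> 'k) \<Rightarrow> bool" where
  "integrable_family f \<longleftrightarrow> (\<forall>i. integrable M (f i))"

lemma integrable_familyD: "integrable_family f \<Longrightarrow> integrable M (f i)"
  by (simp add: integrable_family_def)

lemma cost_nonneg: "0 \<le> cost n f y"
  by (auto simp: cost_def intro!: sum_nonneg mult_nonneg_nonneg)

lemma ex_integrable_family:
  assumes "\<forall>i<n. x i \<in> vcarrier X"
  obtains f where "integrable_family f" "\<And>i. i < n \<Longrightarrow> x i = L1_class M (f i)"
proof -
  \<comment> \<open>Beyond the \<open>n\<close>-th term nothing is known about \<open>x i\<close>,
    and the zero function is taken.\<close>
  have "\<forall>i. \<exists>f. integrable M f \<and> (i < n \<longrightarrow> x i = L1_class M f)"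
    using assms by (metis (no_types) vcarrier_L1_iff integrable_zero)
  then obtain f where "\<forall>i. integrable M (f i) \<and> (i < n \<longrightarrow> x i = L1_class M (f i))" by metis
  then show ?thesis by (intro that[of f]) (auto simp: integrable_family_def)
qed

lemma representation_eq_tens:
  assumes "\<forall>i<n. x i \<in> vcarrier X"
  obtains f where "integrable_family f" "tensor_sum X Y n x y = tens n f y"
    "(\<Sum>i<n. vnorm X (x i) * vnorm Y (y i)) = cost n f y"
proof -
  obtain f where f: "integrable_family f" "\<And>i. i < n \<Longrightarrow> x i = L1_class M (f i)"
    using ex_integrable_family[OF assms] by blast
  show ?thesis
  proof (rule that[OF f(1)])
    show "tensor_sum X Y n x y = tens n f y" using f(2) by (simp add: tensor_sum_def tens_def)
    show "(\<Sum>i<n. vnorm X (x i) * vnorm Y (y i)) = cost n f y"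
      using f by (simp add: cost_def vnorm_L1 integrable_familyD)
  qed
qed

lemma L1_class_carrier: "integrable_family f \<Longrightarrow> L1_class M (f i) \<in> vcarrier X"
  unfolding vcarrier_L1_iff using integrable_familyD by blast

lemma projective_norm_tens:
  "projective_norm X Y u = Inf {cost n f y | n f y. integrable_family f \<and> u = tens n f y}"
proof -
  have "{\<Sum>i<n. vnorm X (x i) * vnorm Y (y i) | n x y.
      (\<forall>i<n. x i \<in> vcarrier X \<and> y i \<in> vcarrier Y) \<and> u = tensor_sum X Y n x y}
    = {cost n f y | n f y. integrable_family f \<and> u = tens n f y}" (is "?A = ?B")
  proof
    show "?A \<subseteq> ?B"
    proof
      fix r assume "r \<in> ?A"
      then obtain n x y where *: "\<forall>i<n. x i \<in> vcarrier X" "u = tensor_sum X Y n x y"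
        "r = (\<Sum>i<n. vnorm X (x i) * vnorm Y (y i))" by blast
      obtain f where "integrable_family f" "tensor_sum X Y n x y = tens n f y"
        "(\<Sum>i<n. vnorm X (x i) * vnorm Y (y i)) = cost n f y"
        by (rule representation_eq_tens[OF *(1)])
      then show "r \<in> ?B" using * by auto
    qed
    show "?B \<subseteq> ?A"
    proof
      fix r assume "r \<in> ?B"
      then obtain n f y where *: "integrable_family f" "u = tens n f y" "r = cost n f y" by blast
      show "r \<in> ?A"
      proof (intro CollectI exI conjI)
        show "r = (\<Sum>i<n. vnorm X (L1_class M (f i)) * vnorm Y (y i))"
          using * by (simp add: cost_def vnorm_L1 integrable_familyD)
        show "u = tensor_sum X Y n (\<lambda>i. L1_class M (f i)) y" using * by (simp add: tens_def)
      qed (use * in \<open>auto simp: L1_class_carrier\<close>)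
    qed
  qed
  then show ?thesis by (simp add: projective_norm_def)
qed

lemma projective_norm_le:
  assumes "integrable_family f"
  shows "projective_norm X Y (tens n f y) \<le> cost n f y"
  unfolding projective_norm_tens
proof (rule cInf_lower)
  show "cost n f y \<in> {cost m g z | m g z. integrable_family g \<and> tens n f y = tens m g z}"
    using assms by blast
  show "bdd_below {cost m g z | m g z. integrable_family g \<and> tens n f y = tens m g z}"
    by (rule bdd_belowI[of _ 0]) (use cost_nonneg in blast)
qed

lemma projective_norm_greatest:
  assumes "integrable_family f"
    and "\<And>m g z. integrable_family g \<Longrightarrow> tens n f y = tens m g z \<Longrightarrow> r \<le> cost m g z"
  shows "r \<le> projective_norm X Y (tens n f y)"
  unfolding projective_norm_tens by (rule cInf_greatest) (use assms in blast)+

lemma vcarrier_tensor_iff: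
  "u \<in> vcarrier (algebraic_tensor X Y) \<longleftrightarrow> (\<exists>n f y. integrable_family f \<and> u = tens n f y)"
proof
  assume "u \<in> vcarrier (algebraic_tensor X Y)"
  then obtain n x y where *: "\<forall>i<n. x i \<in> vcarrier X" "u = tensor_sum X Y n x y"
    by (auto simp: algebraic_tensor_def)
  obtain f where "integrable_family f" "tensor_sum X Y n x y = tens n f y"
    by (rule representation_eq_tens[OF *(1)])
  then show "\<exists>n f y. integrable_family f \<and> u = tens n f y" using *(2) by blast
next
  assume "\<exists>n f y. integrable_family f \<and> u = tens n f y"
  then show "u \<in> vcarrier (algebraic_tensor X Y)"
    using L1_class_carrier unfolding algebraic_tensor_def tens_def by fastforce
qed

lemma tens_eq_sum:
  assumes "bilinear_form X Y B"
  shows "tens n f y B = (\<Sum>i<n. B (L1_class M (f i)) (y i))"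
  using assms by (simp add: tens_def tensor_sum_def elem_tensor_def)

lemma tens_not_bilinear: "\<not> bilinear_form X Y B \<Longrightarrow> tens n f y B = 0"
  by (simp add: tens_def tensor_sum_def elem_tensor_def)

lemma bilinear_formD:
  assumes "bilinear_form X Y B" "integrable M f"
  shows "integrable M g \<Longrightarrow> B (L1_class M (\<lambda>\<omega>. f \<omega> + g \<omega>)) y = B (L1_class M f) y + B (L1_class M g) y"
    and "B (L1_class M (\<lambda>\<omega>. a * f \<omega>)) y = a * B (L1_class M f) y"
    and "B (L1_class M f) (y + z) = B (L1_class M f) y + B (L1_class M f) z"
    and "B (L1_class M f) (scl a y) = a * B (L1_class M f) y"
proof -
  have *: "L1_class M g \<in> vcarrier X" if "integrable M g" for g :: "'a \<Rightarrow> 'k"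
    unfolding vcarrier_L1_iff using that by blast
  note c = *[OF assms(2)]
  show "B (L1_class M (\<lambda>\<omega>. f \<omega> + g \<omega>)) y = B (L1_class M f) y + B (L1_class M g) y"
    if g: "integrable M g"
    unfolding vadd_L1[OF assms(2) g, symmetric] using assms(1) c *[OF g]
    by (simp add: bilinear_form_def)
  show "B (L1_class M (\<lambda>\<omega>. a * f \<omega>)) y = a * B (L1_class M f) y"
    unfolding vscale_L1[OF assms(2), symmetric] using assms(1) c by (simp add: bilinear_form_def)
  show "B (L1_class M f) (y + z) = B (L1_class M f) y + B (L1_class M f) z"
    "B (L1_class M f) (scl a y) = a * B (L1_class M f) y"
    using assms(1) c by (simp_all add: bilinear_form_def)
qed

text \<open>Concatenating two representations represents the sum and adds the costs; this is the
  source of the triangle inequality.\<close>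

lemma tens_append:
  assumes "integrable_family f" "integrable_family g"
  obtains h w where "integrable_family h"
    "tens (n + m) h w = (\<lambda>B. tens n f y B + tens m g z B)" "cost (n + m) h w = cost n f y + cost m g z"
    "\<And>\<omega>. val (n + m) h w \<omega> = val n f y \<omega> + val m g z \<omega>"
proof (rule that)
  let ?h = "\<lambda>i. if i < n then f i else g (i - n)" and ?w = "\<lambda>i. if i < n then y i else z (i - n)"
  show "integrable_family ?h" using assms by (simp add: integrable_family_def)
  show "tens (n + m) ?h ?w = (\<lambda>B. tens n f y B + tens m g z B)"
    by (simp add: tens_def tensor_sum_def sum_lessThan_add)
  show "cost (n + m) ?h ?w = cost n f y + cost m g z"
    by (simp add: cost_def sum_lessThan_add)
  show "val (n + m) ?h ?w \<omega> = val n f y \<omega> + val m g z \<omega>" for \<omega>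
    by (simp add: val_def sum_lessThan_add)
qed

lemma tens_scale:
  assumes "integrable_family f"
  shows "(\<lambda>B. a * tens n f y B) = tens n (\<lambda>i \<omega>. a * f i \<omega>) y"
proof
  fix B show "a * tens n f y B = tens n (\<lambda>i \<omega>. a * f i \<omega>) y B"
    using assms by (cases "bilinear_form X Y B")
      (simp_all add: tens_eq_sum tens_not_bilinear bilinear_formD integrable_familyD sum_distrib_left)
qed

lemma cost_scale: "cost n (\<lambda>i \<omega>. a * f i \<omega>) y = norm a * cost n f y"
  by (simp add: cost_def norm_mult sum_distrib_left mult.assoc)

lemma ex_cost_less:
  assumes "integrable_family f" "e > 0"
  obtains m g z where "integrable_family g" "tens n f y = tens m g z"
    "cost m g z < projective_norm X Y (tens n f y) + e"
proof -
  have "Inf {cost m g z | m g z. integrable_family g \<and> tens n f y = tens m g z}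
      < projective_norm X Y (tens n f y) + e"
    using assms(2) by (simp add: projective_norm_tens)
  from cInf_lessD[OF _ this] show ?thesis using assms(1) that by blast
qed

text \<open>Representations that are optimal up to a small error can be scaled or concatenated,
  which proves the scaling bound and the triangle inequality up to \<open>e\<close>.\<close>

sublocale T: seminormed_functions "algebraic_tensor X Y"
proof
  have simps: "vadd (algebraic_tensor X Y) = (\<lambda>u v b. u b + v b)"
    "vscale (algebraic_tensor X Y) = (\<lambda>a u b. a * u b)"
    "vnorm (algebraic_tensor X Y) = projective_norm X Y"
    by (simp_all add: algebraic_tensor_def)
  show "vadd (algebraic_tensor X Y) = (\<lambda>u v b. u b + v b)"
    "vscale (algebraic_tensor X Y) = (\<lambda>a u b. a * u b)" by (fact simps)+
  fix u assume "u \<in> vcarrier (algebraic_tensor X Y)"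
  then obtain n f y where u: "integrable_family f" "u = tens n f y" by (auto simp: vcarrier_tensor_iff)
  show "0 \<le> vnorm (algebraic_tensor X Y) u"
    unfolding simps u(2) by (rule projective_norm_greatest[OF u(1)]) (rule cost_nonneg)
  fix a
  have af: "integrable_family (\<lambda>i \<omega>. a * f i \<omega>)" if "integrable_family f"
    for f :: "nat \<Rightarrow> 'a \<Rightarrow> 'k" using that by (simp add: integrable_family_def)
  show "vscale (algebraic_tensor X Y) a u \<in> vcarrier (algebraic_tensor X Y)"
    unfolding simps u(2) tens_scale[OF u(1)] vcarrier_tensor_iff using af[OF u(1)] by blast
  show "vnorm (algebraic_tensor X Y) (vscale (algebraic_tensor X Y) a u)
      \<le> norm a * vnorm (algebraic_tensor X Y) u"
  proof (rule field_le_epsilon)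
    fix e :: real assume "e > 0"
    then have e: "e / (norm a + 1) > 0" by (intro divide_pos_pos add_nonneg_pos) auto
    obtain m g z where g: "integrable_family g" "tens n f y = tens m g z"
      "cost m g z < projective_norm X Y (tens n f y) + e / (norm a + 1)"
      by (rule ex_cost_less[OF u(1) e])
    have "projective_norm X Y (\<lambda>b. a * tens n f y b) \<le> norm a * cost m g z"
      using projective_norm_le[OF af[OF g(1)], of m z] by (simp add: g(2) tens_scale[OF g(1)] cost_scale)
    also have "\<dots> \<le> norm a * (projective_norm X Y (tens n f y) + e / (norm a + 1))"
      using g(3) by (intro mult_left_mono) auto
    also have "\<dots> \<le> norm a * projective_norm X Y (tens n f y) + e"
    proof -
      have "norm a + 1 > 0" by (intro add_nonneg_pos) auto
      then have "norm a * (e / (norm a + 1)) \<le> e" using \<open>e > 0\<close> by (simp add: field_simps)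
      then show ?thesis by (simp add: distrib_left)
    qed
    finally show "vnorm (algebraic_tensor X Y) (vscale (algebraic_tensor X Y) a u)
      \<le> norm a * vnorm (algebraic_tensor X Y) u + e" by (simp add: simps u(2))
  qed
  fix v assume "v \<in> vcarrier (algebraic_tensor X Y)"
  then obtain m g z where v: "integrable_family g" "v = tens m g z" by (auto simp: vcarrier_tensor_iff)
  show "vadd (algebraic_tensor X Y) u v \<in> vcarrier (algebraic_tensor X Y)"
    using tens_append[OF u(1) v(1), of n m y z] unfolding simps u(2) v(2) vcarrier_tensor_iff by metis
  show "vnorm (algebraic_tensor X Y) (vadd (algebraic_tensor X Y) u v)
      \<le> vnorm (algebraic_tensor X Y) u + vnorm (algebraic_tensor X Y) v"
  proof (rule field_le_epsilon)
    fix e :: real assume "e > 0"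
    then have e: "e / 2 > 0" by simp
    obtain n' f' y' where f': "integrable_family f'" "tens n f y = tens n' f' y'"
      "cost n' f' y' < projective_norm X Y (tens n f y) + e / 2" by (rule ex_cost_less[OF u(1) e])
    obtain m' g' z' where g': "integrable_family g'" "tens m g z = tens m' g' z'"
      "cost m' g' z' < projective_norm X Y (tens m g z) + e / 2" by (rule ex_cost_less[OF v(1) e])
    obtain h w where h: "integrable_family h"
      "tens (n' + m') h w = (\<lambda>B. tens n' f' y' B + tens m' g' z' B)"
      "cost (n' + m') h w = cost n' f' y' + cost m' g' z'" by (rule tens_append[OF f'(1) g'(1)])
    have "projective_norm X Y (tens (n' + m') h w) \<le> cost n' f' y' + cost m' g' z'"
      using projective_norm_le[OF h(1), of "n' + m'" w] h(3) by simp
    then show "vnorm (algebraic_tensor X Y) (vadd (algebraic_tensor X Y) u v)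
      \<le> vnorm (algebraic_tensor X Y) u + vnorm (algebraic_tensor X Y) v + e"
      using f'(3) g'(3) by (simp add: simps u(2) v(2) h(2) f'(2) g'(2))
  qed
qed

text \<open>Equality of tensors means equality at every bilinear form, so concrete forms are
  required to exploit it. The bound on \<open>w\<close> keeps \<open>w f\<close> integrable;
  \<open>\<phi>\<close> may be unbounded, as coordinate functionals of a Hamel basis can be, because
  the forms are purely algebraic.\<close>

lemma bilinear_form_integral:
  assumes w: "w \<in> borel_measurable M" "\<And>\<omega>. norm (w \<omega>) \<le> 1"
    and \<phi>: "\<And>y z. \<phi> (y + z) = \<phi> y + \<phi> z" "\<And>a y. \<phi> (scl a y) = a * \<phi> y"
  obtains B where "bilinear_form X Y B"
    "\<And>f y. integrable M f \<Longrightarrow> B (L1_class M f) y = (\<integral>\<omega>. w \<omega> * f \<omega> \<partial>M) * \<phi> y"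
proof -
  define B where "B F y = (\<integral>\<omega>. w \<omega> * (SOME f. f \<in> F) \<omega> \<partial>M) * \<phi> y" for F y
  have B: "B (L1_class M f) y = (\<integral>\<omega>. w \<omega> * f \<omega> \<partial>M) * \<phi> y" if f: "integrable M f" for f y
  proof -
    note s = some_L1_class[OF f]
    have "(\<integral>\<omega>. w \<omega> * (SOME g. g \<in> L1_class M f) \<omega> \<partial>M) = (\<integral>\<omega>. w \<omega> * f \<omega> \<partial>M)"
    proof (rule integral_cong_AE)
      show "AE \<omega> in M. w \<omega> * (SOME g. g \<in> L1_class M f) \<omega> = w \<omega> * f \<omega>"
        using s(2) by eventually_elim simp
    qed (use s(1) w f in measurable)
    then show ?thesis by (simp add: B_def)
  qed
  have wf: "integrable M (\<lambda>\<omega>. w \<omega> * f \<omega>)" if "integrable M f" for f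
    by (rule integrable_bounded_mult[OF that w])
  have add: "(\<integral>\<omega>. w \<omega> * (f \<omega> + g \<omega>) \<partial>M) = (\<integral>\<omega>. w \<omega> * f \<omega> \<partial>M) + (\<integral>\<omega>. w \<omega> * g \<omega> \<partial>M)"
    if "integrable M f" "integrable M g" for f g
    using wf that by (simp add: distrib_left)
  have scale: "(\<integral>\<omega>. w \<omega> * (a * f \<omega>) \<partial>M) = a * (\<integral>\<omega>. w \<omega> * f \<omega> \<partial>M)" for a f
    by (simp add: mult.left_commute)
  have "bilinear_form X Y B" unfolding bilinear_form_def nspace_of_simps
  proof (intro conjI ballI allI)
    fix F y a assume "F \<in> vcarrier X"
    then obtain f where f: "integrable M f" "F = L1_class M f" unfolding vcarrier_L1_iff by blast
    show "B (vscale X a F) y = a * B F y"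
      using f by (simp add: vscale_L1 B scale mult.assoc)
    show "B F (scl a y) = a * B F y" using f by (simp add: B \<phi>)
    show "B F (y + y') = B F y + B F y'" for y' using f by (simp add: B \<phi> distrib_left)
    fix G assume "G \<in> vcarrier X"
    then obtain g where g: "integrable M g" "G = L1_class M g" unfolding vcarrier_L1_iff by blast
    show "B (vadd X F G) y = B F y + B G y"
      using f g by (simp add: vadd_L1 B add distrib_right)
  qed
  then show ?thesis using B that by blast
qed

section \<open>Pointwise values and the lower bound for the projective norm\<close>

lemma tendsto_scl: "(a \<longlongrightarrow> l) F \<Longrightarrow> ((\<lambda>n. scl (a n) y) \<longlongrightarrow> scl l y) F"
proof -
  assume "(a \<longlongrightarrow> l) F"
  then have "((\<lambda>n. a n - l) \<longlongrightarrow> 0) F" by (simp add: LIM_zero)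
  then have "((\<lambda>n. scl (a n) y - scl l y) \<longlongrightarrow> 0) F"
    by (rule tendsto_0_le[of _ _ _ "norm y"]) (simp add: norm_scale flip: scale_left_diff_distrib)
  then show ?thesis by (rule LIM_zero_cancel)
qed

text \<open>Since \<open>Y\<close> may be non-separable, measurability is shown for the norm only:
  replacing the scalar coefficients by simple functions exhibits it as a pointwise limit of simple
  functions.\<close>

lemma norm_val_measurable [measurable]:
  assumes "integrable_family f"
  shows "(\<lambda>\<omega>. norm (val n f y \<omega>)) \<in> borel_measurable M"
proof -
  have "\<exists>F. (\<forall>k. simple_function M (F k)) \<and> (\<forall>\<omega>\<in>space M. (\<lambda>k. F k \<omega>) \<longlonglongrightarrow> f i \<omega>)" for i
    using borel_measurable_implies_sequence_metric[OF borel_measurable_integrable[OF integrable_familyD[OF assms]], of i 0]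
    by blast
  then obtain F where F: "\<And>i k. simple_function M (F i k)"
    "\<And>i \<omega>. \<omega> \<in> space M \<Longrightarrow> (\<lambda>k. F i k \<omega>) \<longlonglongrightarrow> f i \<omega>" by metis
  have s: "simple_function M (\<lambda>\<omega>. norm (\<Sum>i<n. scl (F i k \<omega>) (y i)))" for k
    by (intro simple_function_compose1[where g = norm] simple_function_sum
        simple_function_compose1[where g = "\<lambda>a. scl a _"] F)
  show ?thesis
  proof (rule borel_measurable_LIMSEQ_real)
    show "(\<lambda>\<omega>. norm (\<Sum>i<n. scl (F i k \<omega>) (y i))) \<in> borel_measurable M" for k
      using s by (rule borel_measurable_simple_function)
    show "(\<lambda>k. norm (\<Sum>i<n. scl (F i k \<omega>) (y i))) \<longlonglongrightarrow> norm (val n f y \<omega>)" if "\<omega> \<in> space M" for \<omega>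
      unfolding val_def by (intro tendsto_norm tendsto_sum tendsto_scl F that)
  qed
qed

lemma norm_val_le: "norm (val n f y \<omega>) \<le> (\<Sum>i<n. norm (f i \<omega>) * norm (y i))"
  unfolding val_def by (rule sum_norm_le) (simp add: norm_scale)

lemma integrable_norm_val:
  assumes "integrable_family f"
  shows "integrable M (\<lambda>\<omega>. norm (val n f y \<omega>))"
proof (rule Bochner_Integration.integrable_bound)
  show "integrable M (\<lambda>\<omega>. \<Sum>i<n. norm (f i \<omega>) * norm (y i))"
    using assms by (auto simp: integrable_family_def)
  show "AE \<omega> in M. norm (norm (val n f y \<omega>)) \<le> norm (\<Sum>i<n. norm (f i \<omega>) * norm (y i))"
    by (intro AE_I2) (simp add: order_trans[OF norm_val_le abs_ge_self])
qed (rule norm_val_measurable[OF assms])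

lemma integral_norm_val_le_cost:
  assumes "integrable_family f"
  shows "(\<integral>\<omega>. norm (val n f y \<omega>) \<partial>M) \<le> cost n f y"
proof -
  have i: "integrable M (\<lambda>\<omega>. norm (f i \<omega>) * norm (y i))" for i
    using assms by (auto simp: integrable_family_def)
  have "(\<integral>\<omega>. norm (val n f y \<omega>) \<partial>M) \<le> (\<integral>\<omega>. (\<Sum>i<n. norm (f i \<omega>) * norm (y i)) \<partial>M)"
    by (intro integral_mono integrable_norm_val assms norm_val_le Bochner_Integration.integrable_sum i)
  also have "\<dots> = cost n f y" using i by (simp add: cost_def Bochner_Integration.integral_sum)
  finally show ?thesis .
qed

text \<open>The coordinates of both sides with respect to a Hamel basis are compared by means of the
  bilinear forms \<open>(f, y) \<mapsto> (\<integral> w f) \<phi>(y)\<close>, where \<open>\<phi>\<close> is a coordinate functional and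
  \<open>w\<close> is the conjugate sign of the difference of the coordinates.\<close>

lemma val_AE_eq:
  assumes f: "integrable_family f" and g: "integrable_family g" and eq: "tens n f y = tens m g z"
  shows "AE \<omega> in M. val n f y \<omega> = val m g z \<omega>"
proof -
  obtain H where H: "independent H" "span H = UNIV"
    using maximal_independent_subset[of UNIV] by (metis top.extremum_uniqueI)
  let ?c = "representation H"
  have c_add: "?c (u + v) b = ?c u b + ?c v b" for u v b
    using H by (simp add: representation_add)
  have c_scale: "?c (scl a u) b = a * ?c u b" for a u b
    using H by (simp add: representation_scale)
  have c_sum: "?c (\<Sum>i<k. scl (a i) (u i)) b = (\<Sum>i<k. a i * ?c (u i) b)" for k :: nat and a u b
    using H by (simp add: representation_sum representation_scale)
  have coord: "AE \<omega> in M. ?c (val n f y \<omega>) b = ?c (val m g z \<omega>) b" for b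
  proof -
    define h where "h \<omega> = (\<Sum>i<n. f i \<omega> * ?c (y i) b) - (\<Sum>i<m. g i \<omega> * ?c (z i) b)" for \<omega>
    have h_int: "integrable M h" unfolding h_def using f g by (auto simp: integrable_family_def)
    then have [measurable]: "h \<in> borel_measurable M" by simp
    define w where "w \<omega> = (if h \<omega> = 0 then 0 else of_real (norm (h \<omega>)) / h \<omega>)" for \<omega>
    have w: "w \<in> borel_measurable M" unfolding w_def by measurable
    have w1: "norm (w \<omega>) \<le> 1" for \<omega> by (simp add: w_def norm_divide)
    obtain B where B: "bilinear_form X Y B"
      "\<And>f u. integrable M f \<Longrightarrow> B (L1_class M f) u = (\<integral>\<omega>. w \<omega> * f \<omega> \<partial>M) * ?c u b"
      using bilinear_form_integral[OF w w1, of "\<lambda>u. ?c u b"] c_add c_scale by metis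
    have wf: "integrable M (\<lambda>\<omega>. w \<omega> * f i \<omega> * a)" "integrable M (\<lambda>\<omega>. w \<omega> * g i \<omega> * a)" for i a
      by (rule integrable_mult_left, rule integrable_bounded_mult[OF _ w w1],
          use f g in \<open>simp add: integrable_familyD\<close>)+
    have "(\<Sum>i<n. (\<integral>\<omega>. w \<omega> * f i \<omega> \<partial>M) * ?c (y i) b) = (\<Sum>i<m. (\<integral>\<omega>. w \<omega> * g i \<omega> \<partial>M) * ?c (z i) b)"
      using fun_cong[OF eq, of B] f g by (simp add: tens_eq_sum B integrable_family_def)
    then have "(\<integral>\<omega>. w \<omega> * h \<omega> \<partial>M) = 0"
      using wf
      by (simp add: h_def right_diff_distrib sum_distrib_left Bochner_Integration.integral_diff
          Bochner_Integration.integral_sum mult.assoc[symmetric])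
    moreover have "w \<omega> * h \<omega> = of_real (norm (h \<omega>))" for \<omega> by (simp add: w_def)
    ultimately have "(\<integral>\<omega>. of_real (norm (h \<omega>)) \<partial>M) = (0::'k)" by simp
    then have "(\<integral>\<omega>. norm (h \<omega>) \<partial>M) = 0"
      using integral_bounded_linear[where T = "of_real :: real \<Rightarrow> 'k",
          OF bounded_linear_of_real integrable_norm[OF h_int]] by simp
    then have "AE \<omega> in M. norm (h \<omega>) = 0"
      using integral_nonneg_eq_0_iff_AE[of M "\<lambda>\<omega>. norm (h \<omega>)"] h_int by simp
    then show ?thesis by eventually_elim (simp add: h_def val_def c_sum)
  qed
  \<comment> \<open>Only finitely many coordinates are non-zero for some \<open>y i\<close> or
    \<open>z i\<close>, so only finitely many exceptional null sets have to be united.\<close>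
  define S where "S = (\<Union>i<n. {b. ?c (y i) b \<noteq> 0}) \<union> (\<Union>i<m. {b. ?c (z i) b \<noteq> 0})"
  have "finite S" unfolding S_def by (auto simp: finite_representation)
  then have "AE \<omega> in M. \<forall>b\<in>S. ?c (val n f y \<omega>) b = ?c (val m g z \<omega>) b"
    using coord by (simp add: AE_finite_all)
  then show ?thesis
  proof eventually_elim
    case (elim \<omega>)
    have "?c (val n f y \<omega>) b = ?c (val m g z \<omega>) b" for b
    proof (cases "b \<in> S")
      case False
      then show ?thesis by (auto simp: S_def val_def c_sum intro!: sum.neutral)
    qed (use elim in blast)
    then have eq: "?c (val n f y \<omega>) = ?c (val m g z \<omega>)" by (rule ext)
    have rep: "v = (\<Sum>b | ?c v b \<noteq> 0. scl (?c v b) b)" for v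
      using sum_nonzero_representation_eq[OF H(1), of v] H(2) by (simp only: UNIV_I)
    show ?case
      using rep[of "val n f y \<omega>"] unfolding eq rep[of "val m g z \<omega>", symmetric] .
  qed
qed

text \<open>Every other representation of the tensor has almost everywhere the same values, so its
  cost also dominates their integral.\<close>

lemma integral_norm_val_le_projective_norm:
  assumes f: "integrable_family f"
  shows "(\<integral>\<omega>. norm (val n f y \<omega>) \<partial>M) \<le> projective_norm X Y (tens n f y)"
proof (rule projective_norm_greatest[OF f])
  fix m g z assume g: "integrable_family g" and eq: "tens n f y = tens m g z"
  have "(\<integral>\<omega>. norm (val n f y \<omega>) \<partial>M) = (\<integral>\<omega>. norm (val m g z \<omega>) \<partial>M)"
    using f g val_AE_eq[OF f g eq] by (intro integral_cong_AE) auto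
  also have "\<dots> \<le> cost m g z" by (rule integral_norm_val_le_cost[OF g])
  finally show "(\<integral>\<omega>. norm (val n f y \<omega>) \<partial>M) \<le> cost m g z" .
qed

end

section \<open>Norm-attaining tensors\<close>

text \<open>Let \<open>a\<close> be the shorter vector and \<open>x\<close>, \<open>y\<close> the
  normalised vectors. Then \<open>a + b\<close> is the sum of
  \<open>norm a *\<^sub>R (x + y)\<close> and \<open>(norm b - norm a) *\<^sub>R y\<close>. If
  \<open>x\<close> and \<open>y\<close> differed, strict convexity would make the first summand
  shorter than \<open>2 * norm a\<close>, and the norms would not add up.\<close>

lemma strictly_convex_norm_add_eq:
  fixes scl :: "'k::real_or_complex \<Rightarrow> 'y::real_normed_vector \<Rightarrow> 'y" and a b :: 'y
  assumes sc: "strictly_convex (nspace_of scl)"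
    and eq: "norm (a + b) = norm a + norm b" and a: "a \<noteq> 0" and b: "b \<noteq> 0"
  shows "\<exists>c. a = c *\<^sub>R b"
proof -
  have main: "\<exists>c. a = c *\<^sub>R b" if eq: "norm (a + b) = norm a + norm b" and a: "a \<noteq> 0"
    and b: "b \<noteq> 0" and le: "norm a \<le> norm b" for a b :: 'y
  proof (rule ccontr)
    define x where "x = a /\<^sub>R norm a"
    define y where "y = b /\<^sub>R norm b"
    have ax: "a = norm a *\<^sub>R x" and bY: "b = norm b *\<^sub>R y" using a b by (simp_all add: x_def y_def)
    assume n: "\<nexists>c. a = c *\<^sub>R b"
    have "x \<noteq> y"
    proof
      assume "x = y"
      then have "a = norm a *\<^sub>R y" using ax by simp
      then have "a = (norm a * inverse (norm b)) *\<^sub>R b" unfolding y_def scaleR_scaleR .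
      then show False using n by blast
    qed
    moreover have "norm x = 1" "norm y = 1" using a b by (simp_all add: x_def y_def)
    ultimately have "norm (x + y) < 2"
      using sc by (simp add: strictly_convex_def nspace_of_def)
    then have lt: "norm a * norm (x + y) < norm a * 2" using a by simp
    have "a + b = norm a *\<^sub>R (x + y) + (norm b - norm a) *\<^sub>R y"
    proof -
      have "norm a *\<^sub>R (x + y) + (norm b - norm a) *\<^sub>R y = norm a *\<^sub>R x + norm b *\<^sub>R y"
        by (simp add: algebra_simps)
      then show ?thesis by (simp only: ax[symmetric] bY[symmetric])
    qed
    then have "norm (a + b) \<le> norm (norm a *\<^sub>R (x + y)) + norm ((norm b - norm a) *\<^sub>R y)"
      by (metis norm_triangle_ineq)
    also have "\<dots> = norm a * norm (x + y) + (norm b - norm a)"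
      using le \<open>norm y = 1\<close> by simp
    finally show False using lt eq by simp
  qed
  show ?thesis
  proof (cases "norm a \<le> norm b")
    case False
    then obtain c where c: "b = c *\<^sub>R a" using main[of b a] eq a b by (auto simp: add.commute)
    then have "c \<noteq> 0" using b by auto
    then have "a = inverse c *\<^sub>R b" using c by simp
    then show ?thesis ..
  qed (use main eq a b in blast)
qed

section \<open>Optimal representations in the completed tensor product\<close>

context L1_tensor
begin

abbreviation "XY \<equiv> algebraic_tensor X Y"

lemma vnorm_algebraic_tensor: "vnorm XY = projective_norm X Y"
  by (simp add: algebraic_tensor_def)

lemma tens_carrier: "integrable_family f \<Longrightarrow> tens n f y \<in> vcarrier XY"
  using vcarrier_tensor_iff by blast

text \<open>Appending the negated second family represents the difference, to which the lower bound
  for the projective norm applies.\<close>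

lemma integral_norm_diff_val_le:
  assumes f: "integrable_family f" and g: "integrable_family g"
  shows "integrable M (\<lambda>\<omega>. norm (val n f y \<omega> - val m g z \<omega>))"
    and "(\<integral>\<omega>. norm (val n f y \<omega> - val m g z \<omega>) \<partial>M) \<le> vdist XY (tens n f y) (tens m g z)"
proof -
  have g': "integrable_family (\<lambda>i \<omega>. - 1 * g i \<omega>)" using g by (simp add: integrable_family_def)
  obtain h w where h: "integrable_family h"
    "tens (n + m) h w = (\<lambda>B. tens n f y B + tens m (\<lambda>i \<omega>. - 1 * g i \<omega>) z B)"
    "\<And>\<omega>. val (n + m) h w \<omega> = val n f y \<omega> + val m (\<lambda>i \<omega>. - 1 * g i \<omega>) z \<omega>"
    by (rule tens_append[OF f g']) blast
  have v: "val (n + m) h w \<omega> = val n f y \<omega> - val m g z \<omega>" for \<omega>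
    by (simp add: h(3)) (simp add: val_def sum_negf)
  have t: "tens (n + m) h w = (\<lambda>B. tens n f y B - tens m g z B)"
    unfolding h(2) tens_scale[OF g, symmetric] by simp
  show "integrable M (\<lambda>\<omega>. norm (val n f y \<omega> - val m g z \<omega>))"
    using integrable_norm_val[OF h(1), of "n + m" w] by (simp add: v)
  show "(\<integral>\<omega>. norm (val n f y \<omega> - val m g z \<omega>) \<partial>M) \<le> vdist XY (tens n f y) (tens m g z)"
    using integral_norm_val_le_projective_norm[OF h(1), of "n + m" w]
    by (simp add: v t T.vdist_eq vnorm_algebraic_tensor)
qed

text \<open>An optimal finite representation padded with zeros is an optimal infinite one, since its
  partial sums are eventually constant.\<close>

lemma embed_attaining:
  assumes f: "integrable_family f" and eq: "cost n f y = projective_norm X Y (tens n f y)"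
  shows "completion_embed XY (tens n f y) \<in> NA_projective X Y"
proof -
  define x where "x i = L1_class M (if i < n then f i else (\<lambda>_. 0))" for i
  define z where "z i = (if i < n then y i else 0)" for i
  have fam: "integrable_family (\<lambda>i. if i < n then f i else (\<lambda>_. 0))"
    using f by (simp add: integrable_family_def)
  have ts: "tensor_sum X Y k x z = tens n f y" if "k \<ge> n" for k
  proof
    fix B
    have zero: "elem_tensor X Y (x i) (z i) B = 0" if "i \<ge> n" for i
      using that bilinear_formD(4)[of B "\<lambda>_. 0" 0 0] by (simp add: elem_tensor_def x_def z_def)
    have "tensor_sum X Y k x z B = (\<Sum>i<n. elem_tensor X Y (x i) (z i) B)"
      unfolding tensor_sum_def using that zero by (intro sum.mono_neutral_right) auto
    then show "tensor_sum X Y k x z B = tens n f y B"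
      by (simp add: tens_def tensor_sum_def x_def z_def)
  qed
  let ?u = "completion_embed XY (tens n f y)"
  have car: "?u \<in> vcarrier T.\<C>" by (intro T.embed_in_carrier tens_carrier f)
  have "limitin (norm_topology T.\<C>) (\<lambda>k. completion_embed XY (tensor_sum X Y k x z)) ?u sequentially"
    unfolding limitin_def topspace_norm_topology
    using car ts by (auto intro!: eventually_sequentiallyI[of n])
  moreover have "(\<lambda>i. vnorm X (x i) * vnorm Y (z i)) sums vnorm T.\<C> ?u"
  proof -
    have "(\<lambda>i. vnorm X (x i) * vnorm Y (z i)) sums (\<Sum>i<n. vnorm X (x i) * vnorm Y (z i))"
      by (rule sums_finite) (auto simp: z_def)
    also have "(\<Sum>i<n. vnorm X (x i) * vnorm Y (z i)) = cost n f y"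
      unfolding cost_def x_def z_def
      using f by (intro sum.cong) (simp_all add: vnorm_L1 integrable_familyD)
    finally show ?thesis
      using f by (simp add: T.vnorm_embed tens_carrier eq vnorm_algebraic_tensor)
  qed
  moreover have "\<forall>i. x i \<in> vcarrier X" unfolding x_def using L1_class_carrier[OF fam] by blast
  ultimately show ?thesis
    using car unfolding NA_projective_def attains_projective_norm_def nspace_of_simps(1) by blast
qed

text \<open>If \<open>w\<^sub>i = f\<^sub>i(\<omega>) y\<^sub>i\<close> are the terms of an optimal representation of \<open>v\<close>, then
  \<open>\<parallel>v - w\<^sub>i\<parallel> + \<parallel>w\<^sub>i\<parallel>\<close> has integral at most the projective norm of \<open>v\<close>, which is the integral of
  \<open>\<parallel>v\<parallel>\<close>. Hence the triangle inequality is almost everywhere an equality, and strict convexity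
  puts every non-zero \<open>w\<^sub>i\<close> on the line through \<open>v\<close>.\<close>

lemma attaining_AE_lines:
  assumes sc: "strictly_convex Y" and f: "integrable_family f"
    and norm_eq: "projective_norm X Y (tens n f y) = (\<integral>\<omega>. norm (val n f y \<omega>) \<partial>M)"
    and att: "completion_embed XY (tens n f y) \<in> NA_projective X Y"
  obtains z :: "nat \<Rightarrow> 'y" where "AE \<omega> in M. val n f y \<omega> \<noteq> 0 \<longrightarrow> (\<exists>i a. val n f y \<omega> = scl a (z i))"
proof -
  let ?v = "val n f y" and ?u = "tens n f y"
  obtain x z where x: "\<forall>i. x i \<in> vcarrier X"
    and lim: "limitin (norm_topology T.\<C>) (\<lambda>k. completion_embed XY (tensor_sum X Y k x z))
        (completion_embed XY ?u) sequentially"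
    and sums: "(\<lambda>i. vnorm X (x i) * vnorm Y (z i)) sums vnorm T.\<C> (completion_embed XY ?u)"
    using att unfolding NA_projective_def attains_projective_norm_def by blast
  obtain g where g: "integrable_family g" "\<And>i. x i = L1_class M (g i)"
    using x unfolding vcarrier_L1_iff integrable_family_def by metis
  have ts: "tensor_sum X Y k x z = tens k g z" for k
    by (simp add: tens_def g(2)[abs_def])
  have dist0: "(\<lambda>k. vdist XY ?u (tens k g z)) \<longlonglongrightarrow> 0"
    by (rule T.limitin_embedD[OF lim[unfolded ts]]) (intro tens_carrier f g(1))+
  \<comment> \<open>The projective distance dominates the mean distance, so the partial sums
    converge to \<open>?v\<close> in mean.\<close>
  have D0: "(\<lambda>k. \<integral>\<omega>. norm (?v \<omega> - val k g z \<omega>) \<partial>M) \<longlonglongrightarrow> 0"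
    by (rule tendsto_sandwich[OF _ _ tendsto_const dist0])
      (auto intro!: always_eventually integral_norm_diff_val_le f g(1))
  have cost_lim: "(\<lambda>k. cost k g z) \<longlonglongrightarrow> (\<integral>\<omega>. norm (?v \<omega>) \<partial>M)"
    using sums f g(1) by (simp add: sums_def cost_def g(2) vnorm_L1 integrable_familyD T.vnorm_embed
        tens_carrier vnorm_algebraic_tensor norm_eq)
  define w where "w i \<omega> = scl (g i \<omega>) (z i)" for i \<omega>
  have val_w: "val k g z \<omega> = (\<Sum>i<k. w i \<omega>)" for k \<omega> by (simp add: val_def w_def)
  have w1: "w i \<omega> = val 1 (\<lambda>_. g i) (\<lambda>_. z i) \<omega>" for i \<omega> by (simp add: val_def w_def)
  have gi: "integrable_family (\<lambda>_. g i)" for i using g(1) by (simp add: integrable_family_def)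
  have wi: "integrable M (\<lambda>\<omega>. norm (w i \<omega>))" for i
    unfolding w1 by (rule integrable_norm_val[OF gi])
  have vi: "integrable M (\<lambda>\<omega>. norm (?v \<omega>))" by (rule integrable_norm_val[OF f])
  have vwi: "integrable M (\<lambda>\<omega>. norm (?v \<omega> - w i \<omega>))" for i
    unfolding w1 by (rule integral_norm_diff_val_le[OF f gi])
  have Di: "integrable M (\<lambda>\<omega>. norm (?v \<omega> - val k g z \<omega>))" for k
    by (rule integral_norm_diff_val_le[OF f g(1)])
  have cost_w: "cost k g z = (\<integral>\<omega>. (\<Sum>i<k. norm (w i \<omega>)) \<partial>M)" for k
    using wi by (subst Bochner_Integration.integral_sum) (simp_all add: cost_def w_def norm_scale)
  have eq: "AE \<omega> in M. norm (?v \<omega> - w i \<omega>) + norm (w i \<omega>) - norm (?v \<omega>) = 0" for i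
  proof -
    \<comment> \<open>The \<open>i\<close>-th term is split off from the \<open>k\<close>-th partial
      sum, and the other terms are estimated by their norms.\<close>
    have le: "(\<integral>\<omega>. norm (?v \<omega> - w i \<omega>) \<partial>M) + (\<integral>\<omega>. norm (w i \<omega>) \<partial>M)
        \<le> (\<integral>\<omega>. norm (?v \<omega> - val k g z \<omega>) \<partial>M) + cost k g z" if "k > i" for k
    proof -
      have "norm (?v \<omega> - w i \<omega>) + norm (w i \<omega>)
          \<le> norm (?v \<omega> - val k g z \<omega>) + (\<Sum>j<k. norm (w j \<omega>))" for \<omega>
      proof -
        have s: "(\<Sum>j<k. h j) = h i + (\<Sum>j\<in>{..<k} - {i}. h j)" for h :: "nat \<Rightarrow> 'c::comm_monoid_add"
          using that by (intro sum.remove) auto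
        have "?v \<omega> - w i \<omega> = (?v \<omega> - val k g z \<omega>) + (\<Sum>j\<in>{..<k} - {i}. w j \<omega>)"
          by (simp add: val_w s)
        then have "norm (?v \<omega> - w i \<omega>)
            \<le> norm (?v \<omega> - val k g z \<omega>) + norm (\<Sum>j\<in>{..<k} - {i}. w j \<omega>)"
          by (metis norm_triangle_ineq)
        also have "norm (\<Sum>j\<in>{..<k} - {i}. w j \<omega>) \<le> (\<Sum>j\<in>{..<k} - {i}. norm (w j \<omega>))"
          by (rule norm_sum)
        finally show ?thesis by (simp add: s)
      qed
      then have "(\<integral>\<omega>. norm (?v \<omega> - w i \<omega>) + norm (w i \<omega>) \<partial>M)
          \<le> (\<integral>\<omega>. norm (?v \<omega> - val k g z \<omega>) + (\<Sum>j<k. norm (w j \<omega>)) \<partial>M)"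
        using vwi wi Di by (intro integral_mono) auto
      then show ?thesis using vwi wi Di by (simp add: cost_w)
    qed
    \<comment> \<open>As \<open>k\<close> grows, the mean error vanishes and, the representation
      being optimal, the costs tend to the integral of \<open>norm (?v \<omega>)\<close>.\<close>
    have "(\<integral>\<omega>. norm (?v \<omega> - w i \<omega>) \<partial>M) + (\<integral>\<omega>. norm (w i \<omega>) \<partial>M)
        \<le> 0 + (\<integral>\<omega>. norm (?v \<omega>) \<partial>M)"
      by (rule tendsto_lowerbound[OF tendsto_add[OF D0 cost_lim]])
        (auto intro!: eventually_sequentiallyI[of "Suc i"] le)
    then have "(\<integral>\<omega>. norm (?v \<omega> - w i \<omega>) + norm (w i \<omega>) - norm (?v \<omega>) \<partial>M) \<le> 0"
      using vwi wi vi by simp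
    moreover have ge: "0 \<le> norm (?v \<omega> - w i \<omega>) + norm (w i \<omega>) - norm (?v \<omega>)" for \<omega>
      using norm_triangle_ineq[of "?v \<omega> - w i \<omega>" "w i \<omega>"] by simp
    moreover have "0 \<le> (\<integral>\<omega>. norm (?v \<omega> - w i \<omega>) + norm (w i \<omega>) - norm (?v \<omega>) \<partial>M)"
      using ge by (intro Bochner_Integration.integral_nonneg)
    ultimately show ?thesis
      using vwi wi vi by (subst integral_nonneg_eq_0_iff_AE[symmetric]) auto
  qed
  \<comment> \<open>Pointwise convergence along a subsequence ensures that some term
    \<open>w i\<close> is non-zero wherever \<open>?v\<close> is.\<close>
  obtain r where r: "AE \<omega> in M. (\<lambda>k. norm (?v \<omega> - val (r k) g z \<omega>)) \<longlonglongrightarrow> 0"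
    using tendsto_L1_AE_subseq[where u = "\<lambda>k \<omega>. norm (?v \<omega> - val k g z \<omega>)", OF Di] D0 by auto
  have "AE \<omega> in M. \<forall>i. norm (?v \<omega> - w i \<omega>) + norm (w i \<omega>) - norm (?v \<omega>) = 0"
    using eq by (simp add: AE_all_countable)
  then have "AE \<omega> in M. ?v \<omega> \<noteq> 0 \<longrightarrow> (\<exists>i a. ?v \<omega> = scl a (z i))"
    using r
  proof eventually_elim
    case (elim \<omega>)
    show ?case
    proof
      assume v0: "?v \<omega> \<noteq> 0"
      have "\<exists>i. w i \<omega> \<noteq> 0"
      proof (rule ccontr)
        assume "\<nexists>i. w i \<omega> \<noteq> 0"
        then have "(\<lambda>_::nat. norm (?v \<omega>)) \<longlonglongrightarrow> 0" using elim(2) by (simp add: val_w)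
        then show False using v0 by (simp add: LIMSEQ_const_iff)
      qed
      then obtain i where i: "w i \<omega> \<noteq> 0" by blast
      have "\<exists>c. ?v \<omega> = c *\<^sub>R w i \<omega>"
      proof (cases "?v \<omega> - w i \<omega> = 0")
        case True
        then show ?thesis by (intro exI[of _ 1]) simp
      next
        case False
        have "norm (?v \<omega> - w i \<omega> + w i \<omega>) = norm (?v \<omega> - w i \<omega>) + norm (w i \<omega>)"
          using elim(1)[rule_format, of i] by simp
        from strictly_convex_norm_add_eq[OF sc this False i]
        obtain c where "?v \<omega> - w i \<omega> = c *\<^sub>R w i \<omega>" by blast
        then show ?thesis by (intro exI[of _ "c + 1"]) (simp add: algebra_simps)
      qed
      then obtain c where "?v \<omega> = scl (of_real c * g i \<omega>) (z i)"
        by (auto simp: w_def scale_of_real[symmetric])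
      then show "\<exists>i a. ?v \<omega> = scl a (z i)" by blast
    qed
  qed
  then show ?thesis by (rule that)
qed

end

section \<open>Tensors of the form g \<otimes> e1 + 1 \<otimes> e2\<close>

locale L1_tensor_pair = L1_tensor scl M
  for scl :: "'k::real_or_complex \<Rightarrow> 'y::real_normed_vector \<Rightarrow> 'y" and M :: "'a measure" +
  fixes E :: "'a set" and e\<^sub>1 e\<^sub>2 :: 'y
  assumes E: "E \<in> sets M" "emeasure M E < \<infinity>"
    and independent: "scl a e\<^sub>1 + scl b e\<^sub>2 = 0 \<Longrightarrow> a = 0 \<and> b = 0"
begin

text \<open>Only the indices 0 and 1 enter the tensor. Over \<open>E\<close> its values
  \<open>g \<omega> *\<^sub>R e\<^sub>1 + e\<^sub>2\<close> lie on an affine line missing the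
  origin, and \<open>g\<close> is the coordinate on that line.\<close>

definition graph_family :: "('a \<Rightarrow> real) \<Rightarrow> nat \<Rightarrow> 'a \<Rightarrow> 'k" where
  "graph_family g i \<omega> = of_real (if i = 0 then g \<omega> else indicator E \<omega>)"

definition graph_vec :: "nat \<Rightarrow> 'y" where
  "graph_vec i = (if i = 0 then e\<^sub>1 else e\<^sub>2)"

definition graph_tensor :: "('a \<Rightarrow> real) \<Rightarrow> ('k, ('a \<Rightarrow> 'k) set, 'y) tensor" where
  "graph_tensor g = tens 2 (graph_family g) graph_vec"

definition graph_val :: "('a \<Rightarrow> real) \<Rightarrow> 'a \<Rightarrow> 'y" where
  "graph_val g \<omega> = g \<omega> *\<^sub>R e\<^sub>1 + indicator E \<omega> *\<^sub>R e\<^sub>2"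

lemma integrable_indicator_E: "integrable M (indicator E :: 'a \<Rightarrow> real)"
  using E by simp

lemma integrable_graph_family: "integrable M g \<Longrightarrow> integrable_family (graph_family g)"
  unfolding integrable_family_def graph_family_def[abs_def]
proof (intro allI integrable_of_real)
  fix i :: nat assume "integrable M g"
  then show "integrable M (\<lambda>\<omega>. if i = 0 then g \<omega> else indicator E \<omega>)"
    using integrable_indicator_E by (cases "i = 0") simp_all
qed

lemma val_graph: "val 2 (graph_family g) graph_vec \<omega> = graph_val g \<omega>"
  by (simp add: val_def numeral_2_eq_2 graph_family_def graph_vec_def graph_val_def scale_of_real)

lemma graph_tensor_carrier: "integrable M g \<Longrightarrow> graph_tensor g \<in> vcarrier XY"
  unfolding graph_tensor_def by (intro tens_carrier integrable_graph_family)

lemma real_independent: "a *\<^sub>R e\<^sub>1 + b *\<^sub>R e\<^sub>2 = 0 \<Longrightarrow> a = 0 \<and> b = 0"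
  using independent[of "of_real a" "of_real b"] by (simp add: scale_of_real)

lemma graph_val_nonzero: "\<omega> \<in> E \<Longrightarrow> graph_val g \<omega> \<noteq> 0"
  using real_independent[of "g \<omega>" 1] by (auto simp: graph_val_def)

text \<open>The second summands cancel, so the difference is the elementary tensor of
  \<open>g - h\<close> and \<open>e\<^sub>1\<close>.\<close>

lemma vdist_graph_tensor_le:
  assumes g: "integrable M g" and h: "integrable M h"
  shows "vdist XY (graph_tensor g) (graph_tensor h) \<le> (\<integral>\<omega>. \<bar>g \<omega> - h \<omega>\<bar> \<partial>M) * norm e\<^sub>1"
proof -
  let ?d = "\<lambda>(_::nat) \<omega>. of_real (g \<omega> - h \<omega>) :: 'k"
  have d: "integrable_family ?d" using g h unfolding integrable_family_def by (intro allI integrable_of_real) simp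
  have g': "integrable M (\<lambda>\<omega>. of_real (g \<omega>) :: 'k)" and h': "integrable M (\<lambda>\<omega>. of_real (h \<omega>) :: 'k)"
    using g h by (auto intro: integrable_of_real)
  have "(\<lambda>B. graph_tensor g B - graph_tensor h B) = tens 1 ?d (\<lambda>_. e\<^sub>1)"
  proof
    fix B show "graph_tensor g B - graph_tensor h B = tens 1 ?d (\<lambda>_. e\<^sub>1) B"
    proof (cases "bilinear_form X Y B")
      case True
      have "B (L1_class M (\<lambda>\<omega>. of_real (g \<omega>) + (- 1) * of_real (h \<omega>))) e\<^sub>1
          = B (L1_class M (\<lambda>\<omega>. of_real (g \<omega>))) e\<^sub>1 + (- 1) * B (L1_class M (\<lambda>\<omega>. of_real (h \<omega>))) e\<^sub>1"
        unfolding bilinear_formD(2)[OF True h', symmetric]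
        by (intro bilinear_formD(1)[OF True g'] integrable_mult_right h')
      then show ?thesis
        by (simp add: graph_tensor_def tens_eq_sum[OF True] numeral_2_eq_2 graph_family_def[abs_def] graph_vec_def)
    qed (simp add: graph_tensor_def tens_not_bilinear)
  qed
  then have "vdist XY (graph_tensor g) (graph_tensor h) = projective_norm X Y (tens 1 ?d (\<lambda>_. e\<^sub>1))"
    by (simp add: T.vdist_eq vnorm_algebraic_tensor)
  also have "\<dots> \<le> cost 1 ?d (\<lambda>_. e\<^sub>1)" by (rule projective_norm_le[OF d])
  also have "\<dots> = (\<integral>\<omega>. \<bar>g \<omega> - h \<omega>\<bar> \<partial>M) * norm e\<^sub>1" by (simp add: cost_def flip: of_real_diff)
  finally show ?thesis .
qed

lemma bilinear_form_sum:
  assumes B: "bilinear_form X Y B" and f: "integrable_family f"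
  shows "B (L1_class M (\<lambda>\<omega>. \<Sum>i<n. a i * f i \<omega>)) y = (\<Sum>i<n. a i * B (L1_class M (f i)) y)"
proof (induction n)
  case 0
  show ?case using bilinear_formD(2)[OF B, of "\<lambda>_. 0" 0 y] by simp
next
  case (Suc n)
  have i: "integrable M (\<lambda>\<omega>. a i * f i \<omega>)" for i using f by (simp add: integrable_family_def)
  then have "integrable M (\<lambda>\<omega>. \<Sum>i<n. a i * f i \<omega>)" by (intro Bochner_Integration.integrable_sum)
  from bilinear_formD(1)[OF B this i[of n], of y] show ?case
    using Suc f by (simp add: bilinear_formD(2)[OF B] integrable_familyD)
qed

text \<open>Vanishing off \<open>E\<close> lets the level sets inside \<open>E\<close> carry the
  whole tensor.\<close>

definition finite_valued :: "('a \<Rightarrow> real) \<Rightarrow> bool" where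
  "finite_valued g \<longleftrightarrow> integrable M g \<and> finite (g ` E) \<and> (\<forall>\<omega>. \<omega> \<notin> E \<longrightarrow> g \<omega> = 0)"

text \<open>Group by level sets: the tensor is the sum of the indicators of \<open>S i\<close>
  tensored with \<open>h i *\<^sub>R e\<^sub>1 + e\<^sub>2\<close>. As the \<open>S i\<close> are
  disjoint, no cancellation takes place and the cost equals the integral of the norm.\<close>

lemma finite_valued_representation:
  assumes g: "finite_valued g"
  obtains n f y where "integrable_family f" "graph_tensor g = tens n f y"
    "cost n f y = (\<integral>\<omega>. norm (graph_val g \<omega>) \<partial>M)"
proof -
  have fin: "finite (g ` E)" and int: "integrable M g" and off: "\<And>\<omega>. \<omega> \<notin> E \<Longrightarrow> g \<omega> = 0"
    using g by (auto simp: finite_valued_def)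
  obtain h where h: "bij_betw h {..<card (g ` E)} (g ` E)"
    using ex_bij_betw_nat_finite[OF fin] by (auto simp: atLeast0LessThan)
  let ?n = "card (g ` E)"
  define S where "S i = {\<omega>\<in>E. g \<omega> = h i}" for i
  define f :: "nat \<Rightarrow> 'a \<Rightarrow> 'k" where "f i \<omega> = of_real (indicator (S i) \<omega>)" for i \<omega>
  define y where "y i = h i *\<^sub>R e\<^sub>1 + e\<^sub>2" for i
  have S: "S i \<in> sets M" for i
  proof -
    have "S i = g -` {h i} \<inter> space M \<inter> E" using sets.sets_into_space[OF E(1)] by (auto simp: S_def)
    then show ?thesis using E(1) borel_measurable_integrable[OF int]
      by (auto intro!: sets.Int measurable_sets[of g M borel])
  qed
  have "emeasure M (S i) < \<infinity>" for i
    using emeasure_mono[of "S i" E M] E by (auto simp: S_def less_top intro: le_less_trans)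
  then have f: "integrable_family f" unfolding integrable_family_def f_def[abs_def]
    using S by (intro allI integrable_of_real) simp
  have "\<forall>\<omega>\<in>E. \<exists>j<?n. g \<omega> = h j"
    using bij_betw_imp_surj_on[OF h] by blast
  then obtain j where j: "\<And>\<omega>. \<omega> \<in> E \<Longrightarrow> j \<omega> < ?n" "\<And>\<omega>. \<omega> \<in> E \<Longrightarrow> g \<omega> = h (j \<omega>)" by metis
  \<comment> \<open>A point of \<open>E\<close> lies in exactly one level set, the one with index
    \<open>j \<omega>\<close>. The three sums below are instances.\<close>
  have pick: "(\<Sum>i<?n. indicator (S i) \<omega> * c i) = (if \<omega> \<in> E then c (j \<omega>) else 0)"
    for \<omega> and c :: "nat \<Rightarrow> real"
  proof (cases "\<omega> \<in> E")
    case True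
    have "\<omega> \<in> S i \<longleftrightarrow> i = j \<omega>" if "i < ?n" for i
      using True that j[OF True] inj_onD[OF bij_betw_imp_inj_on[OF h], of "j \<omega>" i]
      by (auto simp: S_def)
    then have "(\<Sum>i<?n. indicator (S i) \<omega> * c i) = (\<Sum>i<?n. if i = j \<omega> then c (j \<omega>) else 0)"
      by (intro sum.cong) (auto simp: indicator_def)
    then show ?thesis using True j(1)[OF True] by simp
  qed (simp add: S_def)
  have g_sum: "g \<omega> = (\<Sum>i<?n. indicator (S i) \<omega> * h i)" for \<omega>
    unfolding pick using j(2)[of \<omega>] off[of \<omega>] by presburger
  have E_sum: "indicator E \<omega> = (\<Sum>i<?n. indicator (S i) \<omega> * 1 :: real)" for \<omega>
    unfolding pick by (simp add: indicator_def)
  have norm_sum: "norm (graph_val g \<omega>) = (\<Sum>i<?n. indicator (S i) \<omega> * norm (y i))" for \<omega>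
  proof (cases "\<omega> \<in> E")
    case True
    then show ?thesis unfolding pick graph_val_def y_def j(2)[OF True] by simp
  next
    case False
    then show ?thesis unfolding pick graph_val_def off[OF False] by simp
  qed
  show ?thesis
  proof (rule that[OF f])
    show "graph_tensor g = tens ?n f y"
    proof
      fix B show "graph_tensor g B = tens ?n f y B"
      proof (cases "bilinear_form X Y B")
        case B: True
        have 0: "graph_family g 0 = (\<lambda>\<omega>. \<Sum>i<?n. of_real (h i) * f i \<omega>)"
        proof
          fix \<omega>
          have "graph_family g 0 \<omega> = of_real (\<Sum>i<?n. indicator (S i) \<omega> * h i)"
            unfolding graph_family_def by (simp flip: g_sum)
          then show "graph_family g 0 \<omega> = (\<Sum>i<?n. of_real (h i) * f i \<omega>)"
            by (simp only: f_def of_real_sum of_real_mult mult.commute)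
        qed
        have 1: "graph_family g (Suc 0) = (\<lambda>\<omega>. \<Sum>i<?n. 1 * f i \<omega>)"
          by (rule ext, subst graph_family_def, subst E_sum) (simp add: f_def)
        have "B (L1_class M (f i)) (y i) = of_real (h i) * B (L1_class M (f i)) e\<^sub>1 + 1 * B (L1_class M (f i)) e\<^sub>2" for i
          unfolding y_def scale_of_real[symmetric] using f B by (simp add: bilinear_formD integrable_familyD)
        then have "tens ?n f y B = (\<Sum>i<?n. of_real (h i) * B (L1_class M (f i)) e\<^sub>1)
            + (\<Sum>i<?n. 1 * B (L1_class M (f i)) e\<^sub>2)"
          by (simp add: tens_eq_sum[OF B] sum.distrib)
        also have "\<dots> = B (L1_class M (graph_family g 0)) e\<^sub>1 + B (L1_class M (graph_family g (Suc 0))) e\<^sub>2"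
          unfolding 0 1 bilinear_form_sum[OF B f] ..
        also have "\<dots> = graph_tensor g B"
          by (simp add: graph_tensor_def tens_eq_sum[OF B] numeral_2_eq_2 graph_vec_def)
        finally show ?thesis ..
      qed (simp add: graph_tensor_def tens_not_bilinear)
    qed
    have "cost ?n f y = (\<integral>\<omega>. (\<Sum>i<?n. indicator (S i) \<omega> * norm (y i)) \<partial>M)"
    proof -
      have "integrable M (\<lambda>\<omega>. norm (f i \<omega>) * norm (y i))" for i
        using f by (auto simp: integrable_family_def)
      then have "(\<integral>\<omega>. (\<Sum>i<?n. norm (f i \<omega>) * norm (y i)) \<partial>M) = cost ?n f y"
        by (subst Bochner_Integration.integral_sum) (simp_all add: cost_def)
      then show ?thesis by (simp add: f_def del: sum_indicator_mult sum_mult_indicator)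
    qed
    then show "cost ?n f y = (\<integral>\<omega>. norm (graph_val g \<omega>) \<partial>M)" by (simp add: norm_sum)
  qed
qed

lemma integral_graph_val_le:
  "integrable M g \<Longrightarrow> (\<integral>\<omega>. norm (graph_val g \<omega>) \<partial>M) \<le> projective_norm X Y (graph_tensor g)"
  using integral_norm_val_le_projective_norm[OF integrable_graph_family, of g 2 graph_vec]
  by (simp add: val_graph graph_tensor_def)

lemma projective_norm_finite_valued:
  assumes g: "finite_valued g"
  shows "projective_norm X Y (graph_tensor g) = (\<integral>\<omega>. norm (graph_val g \<omega>) \<partial>M)"
proof -
  obtain n f y where *: "integrable_family f" "graph_tensor g = tens n f y"
    "cost n f y = (\<integral>\<omega>. norm (graph_val g \<omega>) \<partial>M)" by (rule finite_valued_representation[OF g])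
  have "projective_norm X Y (graph_tensor g) \<le> (\<integral>\<omega>. norm (graph_val g \<omega>) \<partial>M)"
    using projective_norm_le[OF *(1), of n y] * by simp
  then show ?thesis using integral_graph_val_le[of g] g by (simp add: finite_valued_def)
qed

lemma finite_valued_attains:
  assumes g: "finite_valued g"
  shows "completion_embed XY (graph_tensor g) \<in> NA_projective X Y"
proof -
  obtain n f y where *: "integrable_family f" "graph_tensor g = tens n f y"
    "cost n f y = (\<integral>\<omega>. norm (graph_val g \<omega>) \<partial>M)" by (rule finite_valued_representation[OF g])
  show ?thesis unfolding *(2)
    by (rule embed_attaining[OF *(1)]) (use * projective_norm_finite_valued[OF g] in simp)
qed

lemma integrable_graph_val: "integrable M g \<Longrightarrow> integrable M (\<lambda>\<omega>. norm (graph_val g \<omega>))"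
  using integrable_norm_val[OF integrable_graph_family, of g 2 graph_vec] by (simp add: val_graph)

text \<open>Both sides are Lipschitz in \<open>g\<close> with respect to the mean distance, with
  constant \<open>norm e\<^sub>1\<close>, and they agree for finitely valued functions.\<close>

lemma projective_norm_limit_of_finite_valued:
  assumes g: "integrable M g"
    and approx: "\<And>e. e > 0 \<Longrightarrow> \<exists>h. finite_valued h \<and> (\<integral>\<omega>. \<bar>g \<omega> - h \<omega>\<bar> \<partial>M) < e"
  shows "projective_norm X Y (graph_tensor g) = (\<integral>\<omega>. norm (graph_val g \<omega>) \<partial>M)"
proof (rule antisym[OF field_le_epsilon integral_graph_val_le[OF g]])
  fix e :: real assume "e > 0"
  \<comment> \<open>The factor 2 accounts for the change of the projective norm and of the integral;
    the summand 1 makes positivity immediate.\<close>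
  have pos: "2 * norm e\<^sub>1 + 1 > 0" by (intro add_nonneg_pos) auto
  then have "e / (2 * norm e\<^sub>1 + 1) > 0" using \<open>e > 0\<close> by simp
  then obtain h where h: "finite_valued h" and d: "(\<integral>\<omega>. \<bar>g \<omega> - h \<omega>\<bar> \<partial>M) < e / (2 * norm e\<^sub>1 + 1)"
    using approx by blast
  let ?d = "\<integral>\<omega>. \<bar>g \<omega> - h \<omega>\<bar> \<partial>M"
  have hi: "integrable M h" using h by (simp add: finite_valued_def)
  have "projective_norm X Y (graph_tensor g) \<le> projective_norm X Y (graph_tensor h) + ?d * norm e\<^sub>1"
    using T.vnorm_diff_le[OF graph_tensor_carrier[OF g] graph_tensor_carrier[OF hi]]
      vdist_graph_tensor_le[OF g hi] by (simp add: vnorm_algebraic_tensor)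
  also have "projective_norm X Y (graph_tensor h) = (\<integral>\<omega>. norm (graph_val h \<omega>) \<partial>M)"
    by (rule projective_norm_finite_valued[OF h])
  also have "\<dots> \<le> (\<integral>\<omega>. norm (graph_val g \<omega>) + \<bar>g \<omega> - h \<omega>\<bar> * norm e\<^sub>1 \<partial>M)"
  proof (rule integral_mono)
    show "norm (graph_val h \<omega>) \<le> norm (graph_val g \<omega>) + \<bar>g \<omega> - h \<omega>\<bar> * norm e\<^sub>1" for \<omega>
    proof -
      have "graph_val h \<omega> = graph_val g \<omega> - (g \<omega> - h \<omega>) *\<^sub>R e\<^sub>1"
        by (simp add: graph_val_def algebra_simps)
      then have "norm (graph_val h \<omega>) \<le> norm (graph_val g \<omega>) + norm ((g \<omega> - h \<omega>) *\<^sub>R e\<^sub>1)"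
        by (metis norm_triangle_ineq4)
      then show ?thesis by simp
    qed
  qed (use g hi in \<open>simp_all add: integrable_graph_val\<close>)
  also have "\<dots> = (\<integral>\<omega>. norm (graph_val g \<omega>) \<partial>M) + ?d * norm e\<^sub>1"
    using g hi by (simp add: integrable_graph_val)
  finally have "projective_norm X Y (graph_tensor g)
      \<le> (\<integral>\<omega>. norm (graph_val g \<omega>) \<partial>M) + ?d * norm e\<^sub>1 + ?d * norm e\<^sub>1" by simp
  moreover have "?d * norm e\<^sub>1 + ?d * norm e\<^sub>1 \<le> e"
  proof -
    have "0 \<le> ?d" by simp
    then have "?d * (2 * norm e\<^sub>1) \<le> ?d * (2 * norm e\<^sub>1 + 1)" by (intro mult_left_mono) auto
    also have "\<dots> \<le> e" using d pos by (simp add: pos_less_divide_eq less_imp_le)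
    finally show ?thesis by (simp add: algebra_simps)
  qed
  ultimately show "projective_norm X Y (graph_tensor g) \<le> (\<integral>\<omega>. norm (graph_val g \<omega>) \<partial>M) + e"
    by linarith
qed

text \<open>Eliminating \<open>z\<close> leaves a relation between \<open>e\<^sub>1\<close> and
  \<open>e\<^sub>2\<close>. By independence \<open>a = b\<close> and \<open>a s = a t\<close>, and
  \<open>a\<close> is non-zero because the affine line misses the origin.\<close>

lemma line_meets_graph_once:
  assumes "s *\<^sub>R e\<^sub>1 + e\<^sub>2 = scl a z" "t *\<^sub>R e\<^sub>1 + e\<^sub>2 = scl b z"
  shows "s = t"
proof -
  have "scl (b * of_real s - a * of_real t) e\<^sub>1 + scl (b - a) e\<^sub>2 = scl b (scl a z) - scl a (scl b z)"
    unfolding assms[symmetric] scale_of_real[symmetric]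
    by (simp add: scale_left_diff_distrib scale_right_distrib)
  then have "scl (b * of_real s - a * of_real t) e\<^sub>1 + scl (b - a) e\<^sub>2 = 0"
    by (simp add: mult.commute)
  from independent[OF this] have ab: "b = a" and eq: "a * of_real s = a * (of_real t :: 'k)" by auto
  have "a \<noteq> 0" using assms(1) real_independent[of s 1] by auto
  with eq show "s = t" by simp
qed

text \<open>Each of the countably many lines on which the values lie determines at most one value of
  \<open>g\<close>.\<close>

lemma attains_imp_countable_valued:
  assumes sc: "strictly_convex Y" and g: "integrable M g"
    and norm_eq: "projective_norm X Y (graph_tensor g) = (\<integral>\<omega>. norm (graph_val g \<omega>) \<partial>M)"
    and att: "completion_embed XY (graph_tensor g) \<in> NA_projective X Y"
  obtains C where "countable C" "AE \<omega> in M. \<omega> \<in> E \<longrightarrow> g \<omega> \<in> C"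
proof -
  obtain z :: "nat \<Rightarrow> 'y" where z: "AE \<omega> in M. val 2 (graph_family g) graph_vec \<omega> \<noteq> 0 \<longrightarrow>
      (\<exists>i a. val 2 (graph_family g) graph_vec \<omega> = scl a (z i))"
    by (rule attaining_AE_lines[OF sc integrable_graph_family[OF g], of 2 graph_vec])
      (use norm_eq att in \<open>simp_all add: val_graph graph_tensor_def\<close>)
  define C where "C = (\<Union>i. {t. \<exists>a. t *\<^sub>R e\<^sub>1 + e\<^sub>2 = scl a (z i)})"
  have "countable {t. \<exists>a. t *\<^sub>R e\<^sub>1 + e\<^sub>2 = scl a (z i)}" for i
  proof (cases "{t. \<exists>a. t *\<^sub>R e\<^sub>1 + e\<^sub>2 = scl a (z i)} = {}")
    case False
    then obtain s where "s \<in> {t. \<exists>a. t *\<^sub>R e\<^sub>1 + e\<^sub>2 = scl a (z i)}" by blast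
    then have "{t. \<exists>a. t *\<^sub>R e\<^sub>1 + e\<^sub>2 = scl a (z i)} \<subseteq> {s}" using line_meets_graph_once by blast
    then show ?thesis by (rule countable_subset) simp
  qed (simp only: countable_empty)
  then have "countable C" unfolding C_def by blast
  moreover have "AE \<omega> in M. \<omega> \<in> E \<longrightarrow> g \<omega> \<in> C"
    using z
  proof eventually_elim
    case (elim \<omega>)
    show ?case
    proof
      assume w: "\<omega> \<in> E"
      then obtain i a where "graph_val g \<omega> = scl a (z i)"
        using elim graph_val_nonzero by (auto simp: val_graph)
      with w have "g \<omega> *\<^sub>R e\<^sub>1 + e\<^sub>2 = scl a (z i)" by (simp add: graph_val_def)
      then show "g \<omega> \<in> C" unfolding C_def by blast
    qed
  qed
  ultimately show ?thesis by (rule that)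
qed

end

section \<open>A limit of finitely valued functions\<close>

text \<open>Comparison with a geometric series of ratio \<open>1 / 3\<close>, whose sum supplies the
  factor \<open>3 / 2\<close>.\<close>

lemma suminf_rapid:
  fixes \<epsilon> :: "nat \<Rightarrow> real" and b :: "nat \<Rightarrow> bool"
  assumes pos: "\<And>n. 0 < \<epsilon> n" and step: "\<And>n. \<epsilon> (Suc n) \<le> \<epsilon> n / 3"
  shows "summable (\<lambda>i. \<epsilon> (n + i) * of_bool (b (n + i)))"
    and "0 \<le> (\<Sum>i. \<epsilon> (n + i) * of_bool (b (n + i)))"
    and "(\<Sum>i. \<epsilon> (n + i) * of_bool (b (n + i))) \<le> 3 / 2 * \<epsilon> n"
proof -
  have geo: "\<epsilon> (n + i) \<le> \<epsilon> n * (1 / 3) ^ i" for i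
  proof (induction i)
    case (Suc i)
    then show ?case using step[of "n + i"] by simp
  qed simp
  have sums: "(\<lambda>i. \<epsilon> n * (1 / 3) ^ i) sums (\<epsilon> n * (3 / 2))"
    using sums_mult[OF geometric_sums[of "1 / 3 :: real"], of "\<epsilon> n"] by simp
  have le: "\<epsilon> (n + i) * of_bool (b (n + i)) \<le> \<epsilon> n * (1 / 3) ^ i" for i
    using geo[of i] pos[of "n + i"] pos[of n] by (cases "b (n + i)") auto
  have nn: "0 \<le> \<epsilon> (n + i) * of_bool (b (n + i))" for i using pos[of "n + i"] by simp
  show s: "summable (\<lambda>i. \<epsilon> (n + i) * of_bool (b (n + i)))"
    by (rule summable_comparison_test'[OF sums_summable[OF sums], of 0]) (use le nn in simp)
  show "0 \<le> (\<Sum>i. \<epsilon> (n + i) * of_bool (b (n + i)))" by (rule suminf_nonneg[OF s nn])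
  show "(\<Sum>i. \<epsilon> (n + i) * of_bool (b (n + i))) \<le> 3 / 2 * \<epsilon> n"
    using suminf_le[OF le s sums_summable[OF sums]] sums_unique[OF sums] by simp
qed

text \<open>As for ternary expansions with digits 0 and 2: the tail after index \<open>n\<close> is
  at most \<open>3 / 2 * \<epsilon> (Suc n)\<close>, hence at most \<open>\<epsilon> n / 2\<close>,
  so the leading digit can be read off. Removing it leaves equal tails, and induction
  applies.\<close>

lemma suminf_rapid_inj:
  fixes \<epsilon> :: "nat \<Rightarrow> real" and b b' :: "nat \<Rightarrow> bool"
  assumes pos: "\<And>n. 0 < \<epsilon> n" and step: "\<And>n. \<epsilon> (Suc n) \<le> \<epsilon> n / 3"
    and eq: "(\<Sum>i. \<epsilon> i * of_bool (b i)) = (\<Sum>i. \<epsilon> i * of_bool (b' i))"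
  shows "b n = b' n"
proof -
  define R where "R b n = (\<Sum>i. \<epsilon> (n + i) * of_bool (b (n + i)))" for b n
  note rapid = suminf_rapid[where \<epsilon> = \<epsilon>, OF pos step]
  have R_Suc: "R b n = \<epsilon> n * of_bool (b n) + R b (Suc n)" for b n
    using suminf_split_head[OF rapid(1)[of n b]] by (simp add: R_def)
  have R_bound: "0 \<le> R b n" "R b n \<le> 3 / 2 * \<epsilon> n" for b n
    unfolding R_def by (fact rapid(2) rapid(3))+
  have bit: "b n = b' n" if "R b n = R b' n" for b b' n
    using that R_Suc[of b n] R_Suc[of b' n] R_bound[of b "Suc n"] R_bound[of b' "Suc n"] step[of n] pos[of n]
    by (cases "b n"; cases "b' n") auto
  have "R b n = R b' n" for n
  proof (induction n)
    case 0
    then show ?case using eq by (simp add: R_def)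
  next
    case (Suc n)
    then show ?case using R_Suc[of b n] R_Suc[of b' n] bit[OF Suc] by simp
  qed
  then show ?thesis by (rule bit)
qed

section \<open>Failure of the G-delta property\<close>

context L1_tensor_pair
begin

text \<open>The coefficients \<open>\<epsilon>\<^sub>n\<close> are chosen one after the other. The \<open>n\<close>-th partial sum takes finitely
  many values, hence its tensor lies in the \<open>n\<close>-th open set \<open>U n\<close>, together with a ball; the
  remaining coefficients are so small that the limit stays in this ball.\<close>

lemma adaptive_coefficients:
  assumes A: "\<And>n. A n \<in> sets M" "\<And>n. A n \<subseteq> E"
    and U: "\<And>n. openin (norm_topology (projective_tensor X Y)) (U n)"
      "\<And>n. NA_projective X Y \<subseteq> U n"
    and K: "0 < K"
  shows "\<exists>\<epsilon> p. \<forall>n. 0 < \<epsilon> n \<and> \<epsilon> (Suc n) \<le> \<epsilon> n / 3 \<and> finite_valued (p n) \<and>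
    p n = (\<lambda>\<omega>. \<Sum>i<n. \<epsilon> i * indicator (A i) \<omega>) \<and>
    (\<forall>v\<in>vcarrier T.\<C>. vdist T.\<C> (completion_embed XY (graph_tensor (p n))) v < K * \<epsilon> n \<longrightarrow> v \<in> U n)"
proof -
  \<comment> \<open>A state consists of the \<open>n\<close>-th partial sum and the coefficient for
    the set \<open>A n\<close>. The same number, scaled by \<open>K\<close>, bounds the radius of a
    ball inside \<open>U n\<close>; the construction starts from the empty sum.\<close>
  define P where "P n s \<longleftrightarrow> (case s of (p, e) \<Rightarrow> finite_valued p \<and> 0 < e \<and> (n = 0 \<longrightarrow> p = (\<lambda>_. 0)) \<and>
    (\<forall>v\<in>vcarrier T.\<C>. vdist T.\<C> (completion_embed XY (graph_tensor p)) v < K * e \<longrightarrow> v \<in> U n))"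
    for n and s :: "('a \<Rightarrow> real) \<times> real"
  define Q where "Q n s t \<longleftrightarrow> (case (s, t) of ((p, e), (p', e')) \<Rightarrow>
    p' = (\<lambda>\<omega>. p \<omega> + e * indicator (A n) \<omega>) \<and> e' \<le> e / 3)"
    for n and s t :: "('a \<Rightarrow> real) \<times> real"
  have radius: "\<exists>e. 0 < e \<and> e \<le> d \<and> (\<forall>v\<in>vcarrier T.\<C>.
      vdist T.\<C> (completion_embed XY (graph_tensor p)) v < K * e \<longrightarrow> v \<in> U n)"
    if p: "finite_valued p" and d: "0 < d" for p d n
  proof -
    have "completion_embed XY (graph_tensor p) \<in> U n" using finite_valued_attains[OF p] U(2) by blast
    then obtain r where r: "r > 0" "\<forall>v\<in>vcarrier T.\<C>.
        vdist T.\<C> (completion_embed XY (graph_tensor p)) v < r \<longrightarrow> v \<in> U n"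
      using U(1)[of n] unfolding openin_norm_topology by blast
    have "K * min d (r / K) \<le> r" using K by (simp add: min_def field_simps)
    then show ?thesis using r d K by (intro exI[of _ "min d (r / K)"]) auto
  qed
  have "\<exists>f. \<forall>n. P n (f n) \<and> Q n (f n) (f (Suc n))"
  proof (rule dependent_nat_choice)
    have "finite_valued (\<lambda>_. 0)"
      by (auto simp: finite_valued_def intro: finite_subset[of _ "{0}"])
    then obtain e where "P 0 (\<lambda>_. 0, e)" using radius[of "\<lambda>_. 0" 1 0] by (auto simp: P_def)
    then show "\<exists>s. P 0 s" ..
  next
    fix s n assume s: "P n s"
    obtain p e where pe: "s = (p, e)" by force
    let ?p = "\<lambda>\<omega>. p \<omega> + e * indicator (A n) \<omega>"
    have p: "finite_valued p" "0 < e" using s by (auto simp: P_def pe)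
    have "finite_valued ?p" unfolding finite_valued_def
    proof (intro conjI allI impI)
      have "emeasure M (A n) < \<infinity>" using emeasure_mono[OF A(2) E(1)] E(2) by (rule le_less_trans)
      then show "integrable M ?p" using p A(1)[of n] by (simp add: finite_valued_def)
      have "?p ` E \<subseteq> (\<lambda>(a, b). a + e * b) ` (p ` E \<times> {0, 1})"
        by (auto simp: indicator_def image_iff)
      then show "finite (?p ` E)"
        by (rule finite_subset) (use p in \<open>simp add: finite_valued_def\<close>)
      show "?p \<omega> = 0" if "\<omega> \<notin> E" for \<omega>
        using that p(1) A(2)[of n] by (auto simp: finite_valued_def indicator_def)
    qed
    then obtain e' where e': "0 < e'" "e' \<le> e / 3" "\<forall>v\<in>vcarrier T.\<C>.
        vdist T.\<C> (completion_embed XY (graph_tensor ?p)) v < K * e' \<longrightarrow> v \<in> U (Suc n)"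
      using radius[of ?p "e / 3" "Suc n"] p(2) by auto
    then have "P (Suc n) (?p, e') \<and> Q n s (?p, e')"
      using \<open>finite_valued ?p\<close> by (simp add: P_def Q_def pe)
    then show "\<exists>t. P (Suc n) t \<and> Q n s t" ..
  qed
  then obtain f where f: "\<And>n. P n (f n)" "\<And>n. Q n (f n) (f (Suc n))" by blast
  have rec: "fst (f (Suc n)) = (\<lambda>\<omega>. fst (f n) \<omega> + snd (f n) * indicator (A n) \<omega>)"
    "snd (f (Suc n)) \<le> snd (f n) / 3" for n
    using f(2)[of n] by (simp_all add: Q_def split_beta)
  have P: "finite_valued (fst (f n))" "0 < snd (f n)" "n = 0 \<longrightarrow> fst (f n) = (\<lambda>_. 0)"
    "\<forall>v\<in>vcarrier T.\<C>. vdist T.\<C> (completion_embed XY (graph_tensor (fst (f n)))) v < K * snd (f n) \<longrightarrow> v \<in> U n"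
    for n using f(1)[of n] by (simp_all add: P_def split_beta)
  have sum: "fst (f n) = (\<lambda>\<omega>. \<Sum>i<n. snd (f i) * indicator (A i) \<omega>)" for n
    by (induction n) (use P(3)[of 0] in \<open>simp_all add: rec(1)\<close>)
  show ?thesis
  proof (intro exI[of _ "\<lambda>n. snd (f n)"] exI[of _ "\<lambda>n. fst (f n)"] allI conjI)
    show "fst (f n) = (\<lambda>\<omega>. \<Sum>i<n. snd (f i) * indicator (A i) \<omega>)" for n by (rule sum)
  qed (use P rec(2) in blast)+
qed

text \<open>The limit \<open>g\<close> lands in every \<open>U n\<close>, so its tensor would attain
  the norm and \<open>g\<close> would be almost everywhere countably valued on \<open>E\<close>. But
  the value of \<open>g\<close> determines membership in all \<open>A n\<close>, so its level sets
  in \<open>E\<close> are null, and \<open>E\<close> would be null.\<close>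

lemma not_gdelta_of_separating_sets:
  fixes A :: "nat \<Rightarrow> 'a set"
  assumes sc: "strictly_convex Y"
    and A: "\<And>n. A n \<in> sets M" "\<And>n. A n \<subseteq> E"
    and sep: "\<And>\<omega>. \<omega> \<in> E \<Longrightarrow> \<exists>N\<in>null_sets M. {\<omega>'\<in>E. \<forall>n. \<omega>' \<in> A n \<longleftrightarrow> \<omega> \<in> A n} \<subseteq> N"
    and Epos: "0 < emeasure M E"
  shows "\<not> gdelta_in (norm_topology (projective_tensor X Y)) (NA_projective X Y)"
proof
  assume "gdelta_in (norm_topology (projective_tensor X Y)) (NA_projective X Y)"
  then have "\<exists>U :: nat \<Rightarrow> _. (\<forall>n. openin (norm_topology (projective_tensor X Y)) (U n)) \<and>
      (\<forall>n. U (Suc n) \<subseteq> U n) \<and> \<Inter>(range U) = NA_projective X Y"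
    by (simp only: gdelta_in_descending)
  then obtain U where U: "\<And>n. openin (norm_topology (projective_tensor X Y)) (U n)"
    and NA: "NA_projective X Y = (\<Inter>n::nat. U n)" by metis
  have NAU: "NA_projective X Y \<subseteq> U n" for n unfolding NA by blast
  have e1: "norm e\<^sub>1 > 0" using real_independent[of 1 0] by auto
  define m where "m = measure M E"
  have m: "m > 0" using Epos E unfolding m_def
    by (metis emeasure_eq_ennreal_measure ennreal_0 infinity_ennreal_def less_irrefl zero_less_measure_iff)
  \<comment> \<open>The tensors of \<open>g\<close> and of the \<open>n\<close>-th partial sum
    differ by at most \<open>3 / 2 * \<epsilon> n * m * norm e\<^sub>1\<close>; the factor 2 puts
    the former strictly inside the ball of radius \<open>K * \<epsilon> n\<close>.\<close>
  define K where "K = 2 * m * norm e\<^sub>1"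
  have K: "K > 0" using m e1 by (simp add: K_def)
  from adaptive_coefficients[where A = A and U = U, OF A U NAU K] obtain \<epsilon> p where
    *: "\<forall>n. 0 < \<epsilon> n \<and> \<epsilon> (Suc n) \<le> \<epsilon> n / 3 \<and> finite_valued (p n) \<and>
      p n = (\<lambda>\<omega>. \<Sum>i<n. \<epsilon> i * indicator (A i) \<omega>) \<and>
      (\<forall>v\<in>vcarrier T.\<C>. vdist T.\<C> (completion_embed XY (graph_tensor (p n))) v < K * \<epsilon> n \<longrightarrow> v \<in> U n)"
    by blast
  have pos: "0 < \<epsilon> n" and step: "\<epsilon> (Suc n) \<le> \<epsilon> n / 3" and fv: "finite_valued (p n)"
    and p_eq: "p n = (\<lambda>\<omega>. \<Sum>i<n. \<epsilon> i * indicator (A i) \<omega>)" for n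
    using * by blast+
  have p: "p n \<omega> = (\<Sum>i<n. \<epsilon> i * indicator (A i) \<omega>)" for n \<omega> by (simp only: p_eq)
  have ball: "v \<in> U n" if "v \<in> vcarrier T.\<C>"
    "vdist T.\<C> (completion_embed XY (graph_tensor (p n))) v < K * \<epsilon> n" for n v
    using * that by blast
  note rapid = suminf_rapid[where \<epsilon> = \<epsilon>, OF pos step]
  define g where "g \<omega> = (\<Sum>i. \<epsilon> i * of_bool (\<omega> \<in> A i))" for \<omega>
  have summ: "summable (\<lambda>i. \<epsilon> i * of_bool (\<omega> \<in> A i))" for \<omega>
    using rapid(1)[of 0 "\<lambda>i. \<omega> \<in> A i"] by simp
  have p_lim: "(\<lambda>n. p n \<omega>) \<longlonglongrightarrow> g \<omega>" for \<omega>
    using summable_LIMSEQ[OF summ[of \<omega>]] by (simp add: p g_def indicator_def of_bool_def)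
  have diff: "\<bar>g \<omega> - p n \<omega>\<bar> \<le> 3 / 2 * \<epsilon> n * indicator E \<omega>" for n \<omega>
  proof (cases "\<omega> \<in> E")
    case True
    have "g \<omega> = (\<Sum>i. \<epsilon> (i + n) * of_bool (\<omega> \<in> A (i + n))) + p n \<omega>"
      unfolding g_def using suminf_split_initial_segment[OF summ[of \<omega>], of n]
      by (simp add: p indicator_def of_bool_def)
    then have "g \<omega> - p n \<omega> = (\<Sum>i. \<epsilon> (n + i) * of_bool (\<omega> \<in> A (n + i)))" by (simp add: add.commute)
    then show ?thesis using rapid(2,3)[of n "\<lambda>i. \<omega> \<in> A i"] True by simp
  next
    case False
    then have "\<omega> \<notin> A i" for i using A(2) by blast
    then show ?thesis using False by (simp add: g_def p)
  qed
  have p_int: "integrable M (p n)" for n using fv by (simp add: finite_valued_def)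
  have g_meas: "g \<in> borel_measurable M"
    by (rule borel_measurable_LIMSEQ_real[OF p_lim]) (intro borel_measurable_integrable p_int)
  have g_int: "integrable M g"
  proof (rule Bochner_Integration.integrable_bound)
    show "integrable M (\<lambda>\<omega>. 3 / 2 * \<epsilon> 0 * indicator E \<omega> :: real)" using integrable_indicator_E by simp
    show "AE \<omega> in M. norm (g \<omega>) \<le> norm (3 / 2 * \<epsilon> 0 * indicator E \<omega> :: real)"
      using diff[of _ 0] by (intro AE_I2) (simp add: p order_trans[OF _ abs_ge_self])
  qed (rule g_meas)
  have int_diff: "(\<integral>\<omega>. \<bar>g \<omega> - p n \<omega>\<bar> \<partial>M) \<le> 3 / 2 * \<epsilon> n * m" for n
  proof -
    have "(\<integral>\<omega>. \<bar>g \<omega> - p n \<omega>\<bar> \<partial>M) \<le> (\<integral>\<omega>. 3 / 2 * \<epsilon> n * indicator E \<omega> \<partial>M)"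
      using g_int p_int integrable_indicator_E by (intro integral_mono diff) auto
    also have "\<dots> = 3 / 2 * \<epsilon> n * m"
      using sets.sets_into_space[OF E(1)] by (simp add: m_def Int_absorb2)
    finally show ?thesis .
  qed
  have "\<epsilon> n \<le> \<epsilon> 0 * (1 / 3) ^ n" for n
  proof (induction n)
    case (Suc n)
    then show ?case using step[of n] by simp
  qed simp
  then have eps0: "\<epsilon> \<longlonglongrightarrow> 0"
    using pos by (intro tendsto_sandwich[of "\<lambda>_. 0" \<epsilon> sequentially "\<lambda>n. \<epsilon> 0 * (1 / 3) ^ n"]
        tendsto_mult_right_zero LIMSEQ_power_zero always_eventually) (auto intro: less_imp_le)
  \<comment> \<open>Mean approximation by the partial sums yields the norm formula under which
    attainment forces countably many values.\<close>
  have norm_eq: "projective_norm X Y (graph_tensor g) = (\<integral>\<omega>. norm (graph_val g \<omega>) \<partial>M)"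
  proof (rule projective_norm_limit_of_finite_valued[OF g_int])
    fix e :: real assume "e > 0"
    have "(\<lambda>n. 3 / 2 * \<epsilon> n * m) \<longlonglongrightarrow> 0"
      using tendsto_mult_left_zero[OF tendsto_mult_right_zero[OF eps0]] .
    then have "\<forall>\<^sub>F n in sequentially. 3 / 2 * \<epsilon> n * m < e" using \<open>e > 0\<close> by (rule order_tendstoD)
    then obtain n where "3 / 2 * \<epsilon> n * m < e" by (auto simp: eventually_sequentially)
    then show "\<exists>h. finite_valued h \<and> (\<integral>\<omega>. \<bar>g \<omega> - h \<omega>\<bar> \<partial>M) < e"
      using fv int_diff le_less_trans by blast
  qed
  have "completion_embed XY (graph_tensor g) \<in> U n" for n
  proof (rule ball)
    note c = graph_tensor_carrier[OF g_int] graph_tensor_carrier[OF p_int[of n]]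
    show "completion_embed XY (graph_tensor g) \<in> vcarrier T.\<C>" by (rule T.embed_in_carrier[OF c(1)])
    have "vdist XY (graph_tensor g) (graph_tensor (p n)) \<le> 3 / 2 * \<epsilon> n * m * norm e\<^sub>1"
      using vdist_graph_tensor_le[OF g_int p_int[of n]] mult_right_mono[OF int_diff[of n], of "norm e\<^sub>1"]
      by simp
    also have "\<dots> < K * \<epsilon> n" using pos[of n] m e1 by (simp add: K_def)
    finally show "vdist T.\<C> (completion_embed XY (graph_tensor (p n))) (completion_embed XY (graph_tensor g)) < K * \<epsilon> n"
      by (simp add: T.vdist_embed c T.vdist_commute)
  qed
  then have "completion_embed XY (graph_tensor g) \<in> NA_projective X Y" unfolding NA by blast
  then obtain C where C: "countable C" "AE \<omega> in M. \<omega> \<in> E \<longrightarrow> g \<omega> \<in> C"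
    by (rule attains_imp_countable_valued[OF sc g_int norm_eq])
  \<comment> \<open>Equal sums force equal membership in all \<open>A n\<close>, so a non-empty
    level set in \<open>E\<close> lies in the null set belonging to any one of its points.\<close>
  have level: "AE \<omega> in M. \<not> (\<omega> \<in> E \<and> g \<omega> = c)" for c
  proof (cases "\<exists>\<omega>\<in>E. g \<omega> = c")
    case True
    then obtain \<omega> where w: "\<omega> \<in> E" "g \<omega> = c" by blast
    obtain N where N: "N \<in> null_sets M" "{\<omega>'\<in>E. \<forall>n. \<omega>' \<in> A n \<longleftrightarrow> \<omega> \<in> A n} \<subseteq> N" using sep[OF w(1)] by blast
    show ?thesis
    proof (rule AE_I'[OF N(1)], rule subsetI)
      fix \<omega>' assume "\<omega>' \<in> {\<omega>' \<in> space M. \<not> \<not> (\<omega>' \<in> E \<and> g \<omega>' = c)}"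
      then have w': "\<omega>' \<in> E" "g \<omega>' = g \<omega>" using w by auto
      have "\<omega>' \<in> A n \<longleftrightarrow> \<omega> \<in> A n" for n
        by (rule suminf_rapid_inj[where \<epsilon> = \<epsilon> and b = "\<lambda>n. \<omega>' \<in> A n" and b' = "\<lambda>n. \<omega> \<in> A n", OF pos step])
          (use w'(2) in \<open>simp add: g_def\<close>)
      then show "\<omega>' \<in> N" using N(2) w'(1) by blast
    qed
  qed auto
  have "AE \<omega> in M. \<forall>c\<in>C. \<not> (\<omega> \<in> E \<and> g \<omega> = c)" using level by (subst AE_ball_countable[OF C(1)]) blast
  with C(2) have "AE \<omega> in M. \<omega> \<notin> E" by eventually_elim blast
  then have "emeasure M E = 0" using AE_iff_measurable[OF E(1), of "\<lambda>\<omega>. \<omega> \<notin> E"] sets.sets_into_space[OF E(1)] by auto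
  with Epos show False by simp
qed

end

theorem proposition3p12:
  fixes M :: "'a measure"
    and scl :: "'k::real_or_complex \<Rightarrow> 'y::banach \<Rightarrow> 'y"
  assumes "normed_space_over scl"
    and "strictly_convex (nspace_of scl)"
    and "\<exists>B. \<not> module.dependent scl B \<and> card B = 2"
    and "\<not> purely_atomic M"
  shows "\<not> gdelta_in (norm_topology (projective_tensor (L1 M) (nspace_of scl)))
           (NA_projective (L1 M) (nspace_of scl))"
proof -
  interpret normed_space_over scl by fact
  obtain B where B: "independent B" "card B = 2" using assms(3) by blast
  then obtain e\<^sub>1 e\<^sub>2 where e: "B = {e\<^sub>1, e\<^sub>2}" "e\<^sub>1 \<noteq> e\<^sub>2" by (auto simp: card_2_iff)
  have indep: "a = 0 \<and> b = 0" if "scl a e\<^sub>1 + scl b e\<^sub>2 = 0" for a b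
  proof -
    have "(\<Sum>v\<in>{e\<^sub>1, e\<^sub>2}. scl (if v = e\<^sub>1 then a else b) v) = 0" using that e(2) by simp
    then have "\<forall>v\<in>{e\<^sub>1, e\<^sub>2}. (if v = e\<^sub>1 then a else b) = 0"
      using B(1) e(1) independentD[of "{e\<^sub>1, e\<^sub>2}" "{e\<^sub>1, e\<^sub>2}" "\<lambda>v. if v = e\<^sub>1 then a else b"] by blast
    then show ?thesis using e(2) by auto
  qed
  from assms(4) obtain E where E: "E \<in> sets M" "emeasure M E < \<infinity>" "\<not> purely_atomic_set M E"
    unfolding purely_atomic_def by auto
  from atomless_subset_of_not_purely_atomic_set[OF this]
  obtain F where F: "F \<in> sets M" "F \<subseteq> E" "0 < emeasure M F" "\<And>A. A \<subseteq> F \<Longrightarrow> \<not> atom M A"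
    by auto
  have Ffin: "emeasure M F < \<infinity>"
    using emeasure_mono[OF F(2) E(1)] E(2) by (rule le_less_trans)
  \<comment> \<open>The atomless part \<open>F\<close> takes the place of \<open>E\<close> in the
    construction.\<close>
  interpret L1_tensor_pair scl M F e\<^sub>1 e\<^sub>2
    by unfold_locales (use F(1) Ffin indep in auto)
  show ?thesis
  proof (rule atomless_separating_sets[OF F(1) Ffin])
    show "\<not> atom M A" if "A \<subseteq> F" for A using that by (rule F(4))
  next
    fix A :: "nat \<Rightarrow> 'a set"
    assume "\<And>n. A n \<in> sets M" "\<And>n. A n \<subseteq> F"
      "\<And>\<omega>. \<omega> \<in> F \<Longrightarrow> \<exists>N\<in>null_sets M. {\<omega>'\<in>F. \<forall>n. \<omega>' \<in> A n \<longleftrightarrow> \<omega> \<in> A n} \<subseteq> N"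
    from not_gdelta_of_separating_sets[OF assms(2) this F(3)] show ?thesis .
  qed
qed

end
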